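(* Consider the system $\dot x=f(x,u)$, where $f:\mathbb{R}^n\times\mathbb{R}^m\to\mathbb{R}^n$ is locally Lipschitz continuous with respect to the first argument and the inputs $u$ belong to $\mathcal{U}:=L_\infty(\mathbb{R}_+,\mathbb{R}^m)$, and suppose the system is forward complete. The following statements are equivalent: (i) The system is ISpS. (ii) For every $s>0$ there is a compact nonempty $s$-invariant set $\mathcal{A}\subset\mathbb{R}^n$ such that the system is ISS with respect to $\mathcal{A}$. (iii) The system is compact ISS, i.e. there is a compact nonempty $0$-invariant set $\mathcal{A}\subset\mathbb{R}^n$ such that the system is UAG with respect to $\mathcal{A}$. (iv) There is a bounded nonempty set $\mathcal{A}\subset\mathbb{R}^n$ such that the system is LIM with respect to $\mathcal{A}$.
   Context: Notation: $\mathbb{R}_+=[0,\infty)$. For nonempty $\mathcal{A}\subset\mathbb{R}^n$, $\|x\|_{\mathcal{A}}:=\inf_{y\in\mathcal{A}}\|x-y\|$; $B_r(\mathcal{A})=\{x:\|x\|_{\mathcal{A}}<r\}$; bars denote closures. $\mathcal{U}=L_\infty(\mathbb{R}_+,\mathbb{R}^m)$ is the space of Lebesgue measurable, globally essentially bounded functions with essential supremum norm $\|\cdot\|_{\mathcal{U}}$. $\phi(t,x,u)$ denotes the solution at time $t$ of $\dot x=f(x,u)$ with initial state $x$ and input $u$; forward completeness means that it is well defined for all $(t,x,u)\in\mathbb{R}_+\times\mathbb{R}^n\times\mathcal{U}$. $\mathcal{K}$: continuous strictly increasing $\gamma:\mathbb{R}_+\to\mathbb{R}_+$ with $\gamma(0)=0$;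 $\mathcal{K}_\infty$: unbounded elements of $\mathcal{K}$; $\mathcal{L}$: continuous strictly decreasing $\gamma:\mathbb{R}_+\to\mathbb{R}_+$ with $\lim_{t\to\infty}\gamma(t)=0$; $\mathcal{KL}$: continuous $\beta:\mathbb{R}_+\times\mathbb{R}_+\to\mathbb{R}_+$ with $\beta(\cdot,t)\in\mathcal{K}$ for all $t\ge0$ and $\beta(r,\cdot)\in\mathcal{L}$ for all $r>0$. For $s\ge0$, $\mathcal{A}$ is $s$-invariant if $\phi(t,x,u)\in\mathcal{A}$ for all $t\ge0$, $x\in\mathcal{A}$ and all $u\in\mathcal{U}$ with $\|u\|_{\mathcal{U}}\le s$. ISpS w.r.t. $\mathcal{A}$: there exist $\beta\in\mathcal{KL}$, $\gamma\in\mathcal{K}_\infty$, $c>0$ such that $\|\phi(t,x,u)\|_{\mathcal{A}}\le\beta(\|x\|_{\mathcal{A}},t)+\gamma(\|u\|_{\mathcal{U}})+c$ for all $x\in\mathbb{R}^n,u\in\mathcal{U},t\ge0$. ISS w.r.t. $\mathcal{A}$: the same estimate with $c=0$. The system is ISpS if it is ISpS w.r.t. some bounded nonempty $\mathcal{A}\subset\mathbb{R}^n$. UAG w.r.t. $\mathcal{A}$: there is $\gamma\in\mathcal{K}_\infty$ such that for all $\varepsilon,r>0$ there is $\tau=\tau(\varepsilon,r)<\infty$ such that for all $u\in\mathcal{U}$, $x\in\overline{B_r(\mathcal{A})}$, $t\ge\tau$: $\|\phi(t,x,u)\|_{\mathcal{A}}\le\varepsilon+\gamma(\|u\|_{\mathcal{U}})$.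 LIM w.r.t. $\mathcal{A}$: there is $\gamma\in\mathcal{K}_\infty$ such that for all $x\in\mathbb{R}^n$, $u\in\mathcal{U}$, $\varepsilon>0$ there is $t=t(x,u,\varepsilon)\ge0$ with $\|\phi(t,x,u)\|_{\mathcal{A}}\le\varepsilon+\gamma(\|u\|_{\mathcal{U}})$. *)

theory Defs
  imports "HOL-Analysis.Analysis" "HOL-Probability.Essential_Supremum"
begin

text \<open>Comparison functions are total functions on the reals of which only the
  restriction to \<open>{0..}\<close> matters. Nonnegativity there is implied by the other
  conditions, and so is \<open>\<beta> 0 t = 0\<close> for \<open>\<beta>\<close> in class KL.\<close>

definition class_K :: "(real \<Rightarrow> real) \<Rightarrow> bool" where
  "class_K \<gamma> \<longleftrightarrow> continuous_on {0..} \<gamma> \<and> strict_mono_on {0..} \<gamma> \<and> \<gamma> 0 = 0"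

definition class_K_inf :: "(real \<Rightarrow> real) \<Rightarrow> bool" where
  "class_K_inf \<gamma> \<longleftrightarrow> class_K \<gamma> \<and> \<not> bounded (\<gamma> ` {0..})"

definition class_L :: "(real \<Rightarrow> real) \<Rightarrow> bool" where
  "class_L \<gamma> \<longleftrightarrow> continuous_on {0..} \<gamma> \<and> strict_antimono_on {0..} \<gamma> \<and> (\<gamma> \<longlongrightarrow> 0) at_top"

definition class_KL :: "(real \<Rightarrow> real \<Rightarrow> real) \<Rightarrow> bool" where
  "class_KL \<beta> \<longleftrightarrow>
     continuous_on ({0..} \<times> {0..}) (\<lambda>(r, t). \<beta> r t) \<and>
     (\<forall>t\<ge>0. class_K (\<lambda>r. \<beta> r t)) \<and>
     (\<forall>r>0. class_L (\<lambda>t. \<beta> r t))"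

text \<open>Inputs are represented by functions on the reals of which only the restriction to
  \<open>{0..}\<close> matters. As \<open>esssup\<close> needs a complete linear order, it is taken
  in \<^typ>\<open>ereal\<close>.\<close>

definition inputs :: "(real \<Rightarrow> real ^ 'm) set" where
  "inputs = {u \<in> borel_measurable (lebesgue_on {0..}).
     esssup (lebesgue_on {0..}) (\<lambda>t. ereal (norm (u t))) < \<infinity>}"

definition input_norm :: "(real \<Rightarrow> real ^ 'm) \<Rightarrow> real" where
  "input_norm u = real_of_ereal (esssup (lebesgue_on {0..}) (\<lambda>t. ereal (norm (u t))))"

text \<open>Inputs are merely measurable, so solutions are meant in the sense of Caratheodory:
  locally absolutely continuous curves satisfying the equation almost everywhere, that is,
  solutions of the integral equation.\<close>

definition is_solution ::
  "(real ^ 'n \<Rightarrow> real ^ 'm \<Rightarrow> real ^ 'n) \<Rightarrow> real ^ 'n \<Rightarrow> (real \<Rightarrow> real ^ 'm)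
    \<Rightarrow> (real \<Rightarrow> real ^ 'n) \<Rightarrow> bool" where
  "is_solution f x u y \<longleftrightarrow>
     (\<forall>t\<ge>0. (\<lambda>s. f (y s) (u s)) absolutely_integrable_on {0..t} \<and>
            y t = x + integral {0..t} (\<lambda>s. f (y s) (u s)))"

definition forward_complete :: "(real ^ 'n \<Rightarrow> real ^ 'm \<Rightarrow> real ^ 'n) \<Rightarrow> bool" where
  "forward_complete f \<longleftrightarrow> (\<forall>x. \<forall>u\<in>inputs. \<exists>y. is_solution f x u y)"

text \<open>For right-hand sides that are locally Lipschitz in the state, any two solutions for
  the same data agree on \<open>{0..}\<close>; their values at negative times are irrelevant.\<close>

definition flow ::
  "(real ^ 'n \<Rightarrow> real ^ 'm \<Rightarrow> real ^ 'n) \<Rightarrow> real \<Rightarrow> real ^ 'n \<Rightarrow> (real \<Rightarrow> real ^ 'm)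
    \<Rightarrow> real ^ 'n" where
  "flow f t x u = (THE z. \<exists>y. is_solution f x u y \<and> y t = z)"

definition set_ball :: "real \<Rightarrow> (real ^ 'n) set \<Rightarrow> (real ^ 'n) set" where
  "set_ball r A = {x. infdist x A < r}"

definition s_invariant ::
  "(real ^ 'n \<Rightarrow> real ^ 'm \<Rightarrow> real ^ 'n) \<Rightarrow> real \<Rightarrow> (real ^ 'n) set \<Rightarrow> bool" where
  "s_invariant f s A \<longleftrightarrow>
     (\<forall>t\<ge>0. \<forall>x\<in>A. \<forall>u\<in>inputs. input_norm u \<le> s \<longrightarrow> flow f t x u \<in> A)"

definition ISpS_wrt ::
  "(real ^ 'n \<Rightarrow> real ^ 'm \<Rightarrow> real ^ 'n) \<Rightarrow> (real ^ 'n) set \<Rightarrow> bool" where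
  "ISpS_wrt f A \<longleftrightarrow>
     (\<exists>\<beta> \<gamma> c. class_KL \<beta> \<and> class_K_inf \<gamma> \<and> c > 0 \<and>
        (\<forall>x. \<forall>u\<in>inputs. \<forall>t\<ge>0.
           infdist (flow f t x u) A \<le> \<beta> (infdist x A) t + \<gamma> (input_norm u) + c))"

definition ISS_wrt ::
  "(real ^ 'n \<Rightarrow> real ^ 'm \<Rightarrow> real ^ 'n) \<Rightarrow> (real ^ 'n) set \<Rightarrow> bool" where
  "ISS_wrt f A \<longleftrightarrow>
     (\<exists>\<beta> \<gamma>. class_KL \<beta> \<and> class_K_inf \<gamma> \<and>
        (\<forall>x. \<forall>u\<in>inputs. \<forall>t\<ge>0.
           infdist (flow f t x u) A \<le> \<beta> (infdist x A) t + \<gamma> (input_norm u)))"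

definition ISpS :: "(real ^ 'n \<Rightarrow> real ^ 'm \<Rightarrow> real ^ 'n) \<Rightarrow> bool" where
  "ISpS f \<longleftrightarrow> (\<exists>A. bounded A \<and> A \<noteq> {} \<and> ISpS_wrt f A)"

definition UAG_wrt ::
  "(real ^ 'n \<Rightarrow> real ^ 'm \<Rightarrow> real ^ 'n) \<Rightarrow> (real ^ 'n) set \<Rightarrow> bool" where
  "UAG_wrt f A \<longleftrightarrow>
     (\<exists>\<gamma>. class_K_inf \<gamma> \<and>
        (\<forall>\<epsilon>>0. \<forall>r>0. \<exists>\<tau>. \<forall>u\<in>inputs. \<forall>x\<in>closure (set_ball r A). \<forall>t\<ge>0. t \<ge> \<tau> \<longrightarrow>
           infdist (flow f t x u) A \<le> \<epsilon> + \<gamma> (input_norm u)))"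

definition LIM_wrt ::
  "(real ^ 'n \<Rightarrow> real ^ 'm \<Rightarrow> real ^ 'n) \<Rightarrow> (real ^ 'n) set \<Rightarrow> bool" where
  "LIM_wrt f A \<longleftrightarrow>
     (\<exists>\<gamma>. class_K_inf \<gamma> \<and>
        (\<forall>x. \<forall>u\<in>inputs. \<forall>\<epsilon>>0. \<exists>t\<ge>0.
           infdist (flow f t x u) A \<le> \<epsilon> + \<gamma> (input_norm u)))"

definition compact_ISS :: "(real ^ 'n \<Rightarrow> real ^ 'm \<Rightarrow> real ^ 'n) \<Rightarrow> bool" where
  "compact_ISS f \<longleftrightarrow> (\<exists>A. compact A \<and> A \<noteq> {} \<and> s_invariant f 0 A \<and> UAG_wrt f A)"

end

theory Submission
  imports Defs
begin

text \<open>The only deep implication is from LIM to ISS with respect to some compact set. Its core is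
  that hitting times are uniform over bounded sets of states and inputs, although the inputs
  carry no useful compactness. If they are not uniform, compactness in the state space alone yields
  a pseudo-trajectory: pieces of trajectories that avoid the target, each starting arbitrarily
  close to the point at which the previous one is supposed to end. As the flow maps are continuous
  and injective, they are open by invariance of domain, with a radius that does not depend on the
  input; so nested balls of initial states shrink to a genuine trajectory close to the
  pseudo-trajectory, and this one contradicts LIM. The same argument shows that reachable
  sets in bounded time are bounded.

  For inputs bounded by \<open>s\<close>, all trajectories therefore enter the bounded reachable set of a
  neighbourhood of the given set after a time that is uniform on bounded sets. The closure of this
  reachable set is the required compact set. As it absorbs in finite time, an
  estimate with \<open>\<beta>(r,t) = \<kappa>(r) e\<^sup>-\<^sup>t\<close> follows from crude bounds on the transient.\<close>

section \<open>Preliminaries\<close>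

text \<open>Two demands shape the argument. First, \<open>f\<close> is controlled only through
  Lipschitz constants in the state, and these are local. Trajectories are therefore compared only
  under a common input, so that the size of \<open>f\<close> never enters, and every estimate needs
  an a priori bound on the trajectory. For the pieces of a pseudo-trajectory this bound must precede
  the choice of the tolerance: for hitting times it comes from bounded reachability, whereas for
  bounded reachability itself the pieces are cut at their first exit from the ball of radius
  \<open>norm p + 1\<close>. Second, one compact set has to serve inputs of all sizes, while ISS
  allows no additive constant. For inputs of norm at most \<open>s\<close> that set is invariant and
  absorbing, so the gain has nothing to do; it only has to dominate a sequence of constants on the
  interval from \<open>s\<close> to infinity, which is possible in class K-infinity because
  \<open>s > 0\<close>. Near the compact set the transient must be bounded linearly by the distance;
  invariance supplies this through comparison with the trajectory of a nearest point.\<close>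

lemma local_lipschitz_compact_convex_uniform:
  fixes f :: "'a::metric_space \<Rightarrow> 'b::real_normed_vector \<Rightarrow> 'c::metric_space"
  assumes lip: "local_lipschitz UNIV UNIV f" and "compact T" "compact X" "convex X"
  shows "\<exists>L. \<forall>v\<in>T. L-lipschitz_on X (f v)"
proof -
  have "\<exists>e L. e > 0 \<and> (\<forall>w\<in>cball v e. L-lipschitz_on (cball x e) (f w))" for v x
    using lip unfolding local_lipschitz_def by (metis Int_UNIV_right UNIV_I)
  then obtain e L where e: "\<And>v x. e v x > 0"
    and L: "\<And>v x w. w \<in> cball v (e v x) \<Longrightarrow> (L v x)-lipschitz_on (cball x (e v x)) (f w)"
    by metis
  define B where "B = (\<lambda>p. ball (fst p) (e (fst p) (snd p)) \<times> ball (snd p) (e (fst p) (snd p)))"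
  have "compact (T \<times> X)" using assms by (simp add: compact_Times)
  moreover have "\<And>p. p \<in> T \<times> X \<Longrightarrow> open (B p)" by (auto simp: B_def open_Times)
  moreover have "T \<times> X \<subseteq> (\<Union>p\<in>T \<times> X. B p)" using e by (force simp: B_def)
  ultimately obtain C where C: "C \<subseteq> T \<times> X" "finite C" "T \<times> X \<subseteq> (\<Union>p\<in>C. B p)"
    by (rule compactE_image)
  \<comment> \<open>The sum dominates each of the finitely many local constants, so \<open>M\<close>
    is a local constant near every point of \<open>X\<close>. Convexity then turns the local bound
    into a global one along the segment \<open>g\<close>.\<close>
  define M where "M = (\<Sum>p\<in>C. \<bar>L (fst p) (snd p)\<bar>)"
  have "M-lipschitz_on X (f v)" if v: "v \<in> T" for v
  proof (rule lipschitz_onI)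
    show "0 \<le> M" by (simp add: M_def sum_nonneg)
    have loc: "\<exists>d>0. M-lipschitz_on (ball x d) (f v)" if x: "x \<in> X" for x
    proof -
      obtain p where p: "p \<in> C" "(v, x) \<in> B p" using C(3) v x by blast
      have "\<bar>L (fst p) (snd p)\<bar> \<le> M"
        unfolding M_def by (rule member_le_sum) (use p C in auto)
      then have "M-lipschitz_on (ball (snd p) (e (fst p) (snd p))) (f v)"
        by (intro lipschitz_on_mono[OF L[of v "fst p" "snd p"]]) (use p in \<open>auto simp: B_def\<close>)
      moreover have "x \<in> ball (snd p) (e (fst p) (snd p))" using p(2) by (simp add: B_def)
      then obtain d where "d > 0" "ball x d \<subseteq> ball (snd p) (e (fst p) (snd p))"
        by (meson open_ball open_contains_ball)
      ultimately show ?thesis using lipschitz_on_subset by blast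
    qed
    fix x y assume xy: "x \<in> X" "y \<in> X"
    define g where "g = (\<lambda>t. x + t *\<^sub>R (y - x))"
    have gX: "g t \<in> X" if "t \<in> {0..1}" for t
    proof -
      have "g t = (1 - t) *\<^sub>R x + t *\<^sub>R y" by (simp add: g_def algebra_simps)
      then show ?thesis using \<open>convex X\<close> xy that by (auto simp: convex_def)
    qed
    have gd: "dist (g s) (g t) = \<bar>s - t\<bar> * dist x y" for s t
    proof -
      have "g s - g t = (s - t) *\<^sub>R (y - x)" by (simp add: g_def algebra_simps)
      then show ?thesis by (simp add: dist_norm norm_minus_commute)
    qed
    have gc: "isCont g t" for t unfolding g_def by (intro continuous_intros)
    have "(M * dist x y)-lipschitz_on {0..1} (\<lambda>t. f v (g t))"
    proof (rule locally_lipschitz_imp_lipschitz)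
      show "0 \<le> M * dist x y" using \<open>0 \<le> M\<close> by simp
      show "continuous_on {0..1} (\<lambda>t. f v (g t))"
      proof (intro continuous_at_imp_continuous_on ballI)
        fix t :: real assume t: "t \<in> {0..1}"
        obtain d where d: "d > 0" "M-lipschitz_on (ball (g t) d) (f v)" using loc[OF gX[OF t]] by blast
        then have "isCont (f v) (g t)"
          by (metis centre_in_ball continuous_on_eq_continuous_at lipschitz_on_continuous_on open_ball)
        then show "isCont (\<lambda>t. f v (g t)) t" using gc isCont_o2 by blast
      qed
      fix t r :: real assume t: "t \<in> {0..<1}" "t < r"
      obtain d where d: "d > 0" "M-lipschitz_on (ball (g t) d) (f v)"
        using loc[of "g t"] gX[of t] t by auto
      \<comment> \<open>The factor 2 puts \<open>g z\<close> strictly inside the ball of radius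
        \<open>d\<close> around \<open>g t\<close>; adding 1 keeps the quotient meaningful when
        \<open>x = y\<close>.\<close>
      define z where "z = min r (t + d / (2 * (dist x y + 1)))"
      have q: "0 < d / (2 * (dist x y + 1))" using d by (simp add: add_nonneg_pos)
      then have z: "t < z" "z \<le> r" "z - t \<le> d / (2 * (dist x y + 1))" using t by (auto simp: z_def)
      have "dist (g t) (g z) \<le> (d / (2 * (dist x y + 1))) * (dist x y + 1)"
        using z(1,3) q unfolding gd by (intro mult_mono) auto
      also have "\<dots> = d / 2" by (simp add: field_simps add_nonneg_eq_0_iff)
      also have "\<dots> < d" using d by simp
      finally have "dist (f v (g z)) (f v (g t)) \<le> M * dist (g z) (g t)"
        using d by (intro lipschitz_onD[OF d(2)]) auto
      also have "\<dots> = M * dist x y * (z - t)" using z by (simp add: gd)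
      finally show "\<exists>z\<in>{t<..r}. dist (f v (g z)) (f v (g t)) \<le> M * dist x y * (z - t)"
        using z by auto
    qed
    from lipschitz_onD[OF this, of 0 1] show "dist (f v x) (f v y) \<le> M * dist x y"
      by (simp add: g_def)
  qed
  then show ?thesis by blast
qed

section \<open>Gronwall estimates and first hitting times\<close>

lemma Gronwall_forward:
  fixes d :: "real \<Rightarrow> real"
  assumes d: "continuous_on {0..T} d" and "L \<ge> 0"
    and le: "\<And>t. t \<in> {0..T} \<Longrightarrow> d t \<le> a + L * integral {0..t} d" and t: "t \<in> {0..T}"
  shows "d t \<le> exp (L * t) * a"
proof -
  define G where "G = (\<lambda>t. a + L * integral {0..t} d)"
  have "G t * exp (- L * t) \<le> G 0 * exp (- L * 0)"
  proof (rule DERIV_nonpos_imp_decreasing_open[where f = "\<lambda>t. G t * exp (- L * t)"])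
    have "d integrable_on {0..T}" using d by (rule integrable_continuous_interval)
    then have "continuous_on {0..T} G"
      unfolding G_def by (intro continuous_intros indefinite_integral_continuous_1)
    then show "continuous_on {0..t} (\<lambda>t. G t * exp (- L * t))"
      by (intro continuous_intros) (rule continuous_on_subset, assumption, use t in auto)
    fix x assume x: "0 < x" "x < t"
    have "((\<lambda>u. integral {0..u} d) has_vector_derivative d x) (at x within {0..T})"
      using integral_has_vector_derivative[OF d, of x] x t by auto
    then have "((\<lambda>u. integral {0..u} d) has_real_derivative d x) (at x)"
      using x t at_within_interior[of x "{0..T}"] by (simp add: has_real_derivative_iff_has_vector_derivative)
    then have "((\<lambda>t. G t * exp (- L * t)) has_real_derivative
        (L * d x * exp (- L * x) + G x * (exp (- L * x) * (- L)))) (at x)"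
      unfolding G_def by (auto intro!: derivative_eq_intros)
    moreover have "L * d x * exp (- L * x) + G x * (exp (- L * x) * (- L)) = L * exp (- L * x) * (d x - G x)"
      by (simp add: algebra_simps)
    moreover have "\<dots> \<le> 0"
      using le[of x] x t \<open>L \<ge> 0\<close> by (intro mult_nonneg_nonpos) (auto simp: G_def)
    ultimately show "\<exists>y. ((\<lambda>t. G t * exp (- L * t)) has_real_derivative y) (at x) \<and> y \<le> 0"
      by metis
  qed (use t in auto)
  then have "G t * exp (- (L * t)) * exp (L * t) \<le> a * exp (L * t)"
    by (intro mult_right_mono) (auto simp: G_def)
  moreover have "G t = G t * exp (- (L * t)) * exp (L * t)" by (simp add: mult.assoc flip: exp_add)
  ultimately have "G t \<le> exp (L * t) * a" by (simp only: mult.commute)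
  moreover have "d t \<le> G t" using le[OF t] by (simp add: G_def)
  ultimately show ?thesis by simp
qed

text \<open>Time reversal of \<open>Gronwall_forward\<close>. It serves to bound the initial
  separation of two trajectories by the final one, which makes the flow maps injective and gives a
  quantitative radius of openness.\<close>

lemma Gronwall_backward:
  fixes d :: "real \<Rightarrow> real"
  assumes d: "continuous_on {0..T} d" and "L \<ge> 0" "T \<ge> 0"
    and le: "\<And>t. t \<in> {0..T} \<Longrightarrow> d t \<le> a + L * integral {t..T} d"
  shows "d 0 \<le> exp (L * T) * a"
proof -
  define e where "e = (\<lambda>t. d (T - t))"
  have "e T \<le> exp (L * T) * a"
  proof (rule Gronwall_forward)
    show "continuous_on {0..T} e"
      unfolding e_def by (intro continuous_on_compose2[OF d] continuous_intros) auto
    fix t assume t: "t \<in> {0..T}"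
    have "integral {0..t} e = integral {- t..0} (\<lambda>x. e (- x))"
      using Henstock_Kurzweil_Integration.integral_reflect_real[of t 0 e] by simp
    also have "\<dots> = integral {T - t..T} d"
      using integral_shift_real_ivl[of "T - t" T T d] by (simp add: e_def add.commute)
    finally show "e t \<le> a + L * integral {0..t} e" using le[of "T - t"] t by (simp add: e_def)
  qed (use assms in auto)
  then show ?thesis by (simp add: e_def)
qed

text \<open>The times at which \<open>g\<close> equals \<open>c\<close> form a nonempty compact set;
  before its least element, a value above \<open>c\<close> would force an earlier crossing. The
  lemma cuts trajectories at their first exit from a region in which bounds are known.\<close>

lemma first_hitting_time:
  fixes g :: "real \<Rightarrow> real"
  assumes g: "continuous_on {0..t} g" and "t \<ge> 0" "g 0 \<le> c" "c \<le> g t"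
  obtains s where "s \<in> {0..t}" "g s = c" "\<And>r. r \<in> {0..s} \<Longrightarrow> g r \<le> c"
proof -
  define Z where "Z = {r \<in> {0..t}. g r = c}"
  have "Z \<noteq> {}"
    using IVT'[of g 0 c t] assms by (auto simp: Z_def)
  have "closed Z"
    unfolding Z_def by (rule continuous_closed_preimage_constant[OF g]) simp
  moreover have "bounded Z" by (rule bounded_subset[of "{0..t}"]) (auto simp: Z_def)
  ultimately have "compact Z" by (simp add: compact_eq_bounded_closed)
  with \<open>Z \<noteq> {}\<close> obtain s where s: "s \<in> Z" "\<And>r. r \<in> Z \<Longrightarrow> s \<le> r"
    using compact_attains_inf[of Z] by metis
  show ?thesis
  proof
    show "s \<in> {0..t}" "g s = c" using s(1) by (auto simp: Z_def)
    fix r assume r: "r \<in> {0..s}"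
    show "g r \<le> c"
    proof (rule ccontr)
      assume "\<not> g r \<le> c"
      moreover have "continuous_on {0..r} g"
        by (rule continuous_on_subset[OF g]) (use r s(1) in \<open>auto simp: Z_def\<close>)
      ultimately obtain q where q: "0 \<le> q" "q \<le> r" "g q = c"
        using IVT'[of g 0 c r] assms(3) r by auto
      then have "s \<le> q" using r s(1) by (intro s(2)) (auto simp: Z_def)
      then have "q = r" using q r by auto
      then show False using q \<open>\<not> g r \<le> c\<close> by simp
    qed
  qed
qed

text \<open>The form \<open>r * \<psi> r\<close> with \<open>\<psi>\<close> nondecreasing and at
  least \<open>1 + \<bar>C\<bar>\<close> gives the value 0 at 0, strict growth and the linear bound.
  For \<open>n = nat \<lceil>r\<rceil>\<close> the \<open>n\<close>-th ramp is at least 1 because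
  \<open>r > n - 1\<close>, and the division by \<open>\<rho>\<close> in its slope is repaid by
  \<open>r \<ge> \<rho>\<close>. So an arbitrary sequence \<open>a\<close> can be dominated away
  from 0.\<close>

lemma class_K_inf_majorant:
  fixes a :: "nat \<Rightarrow> real"
  assumes "\<rho> > 0"
  obtains \<kappa> where "class_K_inf \<kappa>" "\<And>r. r \<ge> 0 \<Longrightarrow> C * r \<le> \<kappa> r" "\<And>r. r \<ge> \<rho> \<Longrightarrow> a (nat \<lceil>r\<rceil>) \<le> \<kappa> r"
proof -
  define F where "F = (\<lambda>N (r::real). 1 + \<bar>C\<bar> + (\<Sum>i<N. (\<bar>a i\<bar> / \<rho>) * max 0 (r - real i + 2)))"
  \<comment> \<open>Locally, \<open>\<psi>\<close> agrees with \<open>F N\<close> for all large \<open>N\<close>, because the further summands vanish.\<close>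
  define \<psi> where "\<psi> = (\<lambda>r. F (nat \<lceil>r\<rceil> + 3) r)"
  have F: "F N r = F M r" if "r + 2 \<le> real N" "r + 2 \<le> real M" for N M r
    using that
  proof (induction N M rule: linorder_wlog)
    case (le N M)
    have "(\<Sum>i<M. (\<bar>a i\<bar> / \<rho>) * max 0 (r - real i + 2)) = (\<Sum>i<N. (\<bar>a i\<bar> / \<rho>) * max 0 (r - real i + 2))"
      by (rule sum.mono_neutral_right) (use le in auto)
    then show ?case by (simp add: F_def)
  qed simp
  have \<psi>: "\<psi> r = F N r" if "r + 3 \<le> real N" for r N
    unfolding \<psi>_def by (rule F) (use that in linarith)+
  have F_mono: "F N r \<le> F N r'" if "r \<le> r'" for N r r'
    unfolding F_def by (intro add_left_mono sum_mono mult_left_mono) (use that assms in auto)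
  have F_ge: "1 + \<bar>C\<bar> \<le> F N r" for N r
    unfolding F_def using assms by (auto intro!: sum_nonneg)
  have mono: "\<psi> r \<le> \<psi> r'" if "r \<le> r'" for r r'
  proof -
    obtain N where "r' + 3 \<le> real N" using real_arch_simple by blast
    then show ?thesis using \<psi>[of r N] \<psi>[of r' N] F_mono[of r r' N] that by simp
  qed
  have cont: "isCont \<psi> r" for r
  proof -
    obtain N where N: "r + 4 \<le> real N" using real_arch_simple by blast
    have "\<forall>\<^sub>F x in nhds r. \<psi> x = F N x"
      unfolding eventually_nhds by (intro exI[of _ "{..<r+1}"]) (use N in \<open>auto intro!: \<psi>\<close>)
    moreover have "isCont (F N) r" unfolding F_def by (intro continuous_intros)
    ultimately show ?thesis by (simp add: isCont_cong)
  qed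
  define \<kappa> where "\<kappa> = (\<lambda>r. r * \<psi> r)"
  have ge: "1 + \<bar>C\<bar> \<le> \<psi> r" for r by (simp add: \<psi>_def F_ge)
  show ?thesis
  proof
    show "C * r \<le> \<kappa> r" if "r \<ge> 0" for r
      using mult_left_mono[OF ge[of r] that] that abs_ge_self[of "C * r"]
      by (simp add: \<kappa>_def algebra_simps abs_mult)
    show "a (nat \<lceil>r\<rceil>) \<le> \<kappa> r" if r: "r \<ge> \<rho>" for r
    proof -
      define n where "n = nat \<lceil>r\<rceil>"
      have n: "r - real n + 2 \<ge> 1" using r assms by (simp add: n_def) linarith
      have "a n \<le> \<rho> * (\<bar>a n\<bar> / \<rho> * 1)" using assms by simp
      also have "\<dots> \<le> r * (\<bar>a n\<bar> / \<rho> * max 0 (r - real n + 2))"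
        using n r assms by (intro mult_mono) auto
      also have "\<dots> \<le> r * (\<Sum>i<n + 3. (\<bar>a i\<bar> / \<rho>) * max 0 (r - real i + 2))"
        using r assms by (intro mult_left_mono member_le_sum) auto
      also have "\<dots> \<le> r * \<psi> r"
        using r assms by (intro mult_left_mono) (auto simp: \<psi>_def F_def n_def)
      finally show ?thesis by (simp add: n_def \<kappa>_def)
    qed
    have "continuous_on {0..} \<kappa>"
      unfolding \<kappa>_def using cont by (intro continuous_intros continuous_at_imp_continuous_on) auto
    moreover have "\<kappa> r < \<kappa> r'" if "0 \<le> r" "r < r'" for r r'
      unfolding \<kappa>_def using that mono[of r r'] ge[of r] ge[of r'] by (intro mult_less_le_imp_less) auto
    moreover have "\<not> bounded (\<kappa> ` {0..})"
    proof
      assume "bounded (\<kappa> ` {0..})"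
      then obtain B where B: "\<And>r. r \<ge> 0 \<Longrightarrow> \<bar>\<kappa> r\<bar> \<le> B" by (auto simp: bounded_iff)
      have "(\<bar>B\<bar> + 1) * 1 \<le> \<kappa> (\<bar>B\<bar> + 1)"
        unfolding \<kappa>_def using ge[of "\<bar>B\<bar> + 1"] by (intro mult_left_mono) auto
      then show False using B[of "\<bar>B\<bar> + 1"] by auto
    qed
    ultimately show "class_K_inf \<kappa>"
      by (auto simp: class_K_inf_def class_K_def \<kappa>_def intro!: strict_mono_onI)
  qed
qed

lemma class_KL_mult_exp:
  assumes "class_K \<kappa>"
  shows "class_KL (\<lambda>r t. \<kappa> r * exp (- t))"
proof -
  have k: "continuous_on {0..} \<kappa>" "strict_mono_on {0..} \<kappa>" "\<kappa> 0 = 0" using assms by (auto simp: class_K_def)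
  have pos: "\<kappa> r > 0" if "r > 0" for r using strict_mono_onD[OF k(2), of 0 r] k that by auto
  have "continuous_on ({0..} \<times> {0..}) (\<lambda>p. \<kappa> (fst p) * exp (- snd p))"
    by (intro continuous_on_mult continuous_on_compose2[OF k(1), of _ fst] continuous_intros) auto
  moreover have "class_K (\<lambda>r. \<kappa> r * exp (- t))" for t
    unfolding class_K_def using k(1,3) strict_mono_onD[OF k(2)]
    by (intro conjI continuous_on_mult continuous_on_const strict_mono_onI) auto
  moreover have "class_L (\<lambda>t. \<kappa> r * exp (- t))" if "r > 0" for r
    unfolding class_L_def
  proof (intro conjI)
    show "continuous_on {0..} (\<lambda>t. \<kappa> r * exp (- t))" by (intro continuous_intros)
    show "strict_antimono_on {0..} (\<lambda>t. \<kappa> r * exp (- t))"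
      using pos[OF that] by (auto intro!: monotone_onI)
    have "((\<lambda>t::real. exp (- t)) \<longlongrightarrow> 0) at_top"
      by (rule filterlim_compose[OF exp_at_bot filterlim_uminus_at_bot_at_top])
    then show "((\<lambda>t. \<kappa> r * exp (- t)) \<longlongrightarrow> 0) at_top" by (rule tendsto_mult_right_zero)
  qed
  ultimately show ?thesis by (simp add: class_KL_def case_prod_beta')
qed

section \<open>Inputs and solutions\<close>

text \<open>The bound holds at every time and measurability on the whole line, so that shifts,
  concatenations and the limits formed below stay inside without null-set bookkeeping. Up to a null
  set of times in \<open>{0..}\<close>, every input of norm at most \<open>s\<close> is of this
  form.\<close>

definition input_ball :: "real \<Rightarrow> (real \<Rightarrow> real ^ 'm) set" where
  "input_ball s = {u \<in> borel_measurable lebesgue. \<forall>t. norm (u t) \<le> s}"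

text \<open>The half-line has positive measure, as it contains the unit interval; over a null space
  \<open>esssup\<close> would be minus infinity.\<close>

lemma esssup_norm_nonneg:
  fixes u :: "real \<Rightarrow> 'a::real_normed_vector"
  shows "0 \<le> esssup (lebesgue_on {0..}) (\<lambda>t. ereal (norm (u t)))"
proof -
  have "1 = emeasure lebesgue {0..1::real}" by simp
  also have "\<dots> \<le> emeasure lebesgue {0::real..}" by (rule emeasure_mono) auto
  finally have "emeasure (lebesgue_on {0::real..}) {0..} \<noteq> 0"
    by (subst emeasure_restrict_space) auto
  then have "esssup (lebesgue_on {0::real..}) (\<lambda>t. 0::ereal) = 0"
    by (intro esssup_const) simp
  then show ?thesis
    using esssup_mono[of "\<lambda>t. 0::ereal" "lebesgue_on {0..}" "\<lambda>t. ereal (norm (u t))"] by simp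
qed

lemma input_norm_nonneg: "0 \<le> input_norm u"
  unfolding input_norm_def by (rule real_of_ereal_pos[OF esssup_norm_nonneg])

lemma input_ball_subset_inputs: "input_ball s \<subseteq> inputs"
  and input_norm_input_ball: "u \<in> input_ball s \<Longrightarrow> input_norm u \<le> s"
proof -
  have *: "u \<in> inputs \<and> input_norm u \<le> s" if "u \<in> input_ball s" for u :: "real \<Rightarrow> real ^ 'm"
  proof -
    have [measurable]: "u \<in> borel_measurable (lebesgue_on {0..})"
      using that by (simp add: input_ball_def measurable_restrict_space1)
    let ?e = "esssup (lebesgue_on {0..}) (\<lambda>t. ereal (norm (u t)))"
    have "?e \<le> ereal s"
      by (rule esssup_I) (use that in \<open>auto simp: input_ball_def\<close>)
    then show ?thesis
      unfolding inputs_def input_norm_def using esssup_norm_nonneg[of u] by (cases ?e) auto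
  qed
  show "input_ball s \<subseteq> inputs" "u \<in> input_ball s \<Longrightarrow> input_norm u \<le> s" using * by blast+
qed

lemma inputs_AE_bounded:
  assumes "u \<in> inputs" "input_norm u \<le> s"
  obtains N where "negligible N" "\<And>t. t \<in> {0..} - N \<Longrightarrow> norm (u t) \<le> s"
proof -
  let ?e = "esssup (lebesgue_on {0..}) (\<lambda>t. ereal (norm (u t)))"
  have "?e \<le> ereal s"
    using assms esssup_norm_nonneg[of u] unfolding inputs_def input_norm_def by (cases ?e) auto
  then have "AE t in lebesgue_on {0..}. norm (u t) \<le> s"
    using esssup_AE[of "\<lambda>t. ereal (norm (u t))" "lebesgue_on {0..}"]
    by (auto elim!: eventually_mono dest: order_trans)
  then have "AE t in lebesgue. t \<in> {0..} \<longrightarrow> norm (u t) \<le> s"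
    by (subst (asm) AE_restrict_space_iff) auto
  then obtain N where "N \<in> null_sets lebesgue" "{t. \<not> (t \<in> {0..} \<longrightarrow> norm (u t) \<le> s)} \<subseteq> N"
    by (auto simp: eventually_ae_filter)
  then show ?thesis using that[of N] by (auto simp: negligible_iff_null_sets)
qed

lemma inputs_ae_eq_input_ball:
  fixes u :: "real \<Rightarrow> real ^ 'm"
  assumes u: "u \<in> inputs" "input_norm u \<le> s"
  obtains v N where "v \<in> input_ball s" "negligible N" "\<And>t. t \<in> {0..} - N \<Longrightarrow> v t = u t"
proof -
  obtain N where N: "negligible N" "\<And>t. t \<in> {0..} - N \<Longrightarrow> norm (u t) \<le> s"
    using inputs_AE_bounded[OF u] by blast
  \<comment> \<open>Values at negative times are arbitrary, possibly nonmeasurable, and are set to 0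
    first; cutting off at \<open>s\<close> then changes \<open>w\<close> only on a null set. The
    value 0 is admissible because \<open>s \<ge> 0\<close>.\<close>
  define w where "w = (\<lambda>t. if t \<in> {0..} then u t else 0)"
  define v where "v = (\<lambda>t. if norm (w t) \<le> s then w t else 0)"
  have [measurable]: "w \<in> borel_measurable lebesgue"
    unfolding w_def using u by (intro borel_measurable_if_I) (auto simp: inputs_def)
  have "v \<in> borel_measurable lebesgue" unfolding v_def by measurable
  moreover have "0 \<le> s" using u input_norm_nonneg[of u] by simp
  ultimately have "v \<in> input_ball s" by (auto simp: input_ball_def v_def)
  moreover have "v t = u t" if "t \<in> {0..} - N" for t using N(2)[OF that] that by (simp add: v_def w_def)
  ultimately show ?thesis using that N(1) by blast
qed

lemma shift_in_input_ball:
  assumes "u \<in> input_ball s"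
  shows "(\<lambda>t. u (c + t)) \<in> input_ball s"
proof -
  have "(\<lambda>x::real. c + x) \<in> lebesgue \<rightarrow>\<^sub>M lebesgue"
    using lebesgue_affine_measurable[of "\<lambda>_::real. 1::real" c] by simp
  then show ?thesis
    using assms measurable_compose[of "\<lambda>x. c + x" lebesgue lebesgue u borel]
    by (auto simp: input_ball_def)
qed

section \<open>Concatenated inputs and solutions on bounded intervals\<close>

definition concat_input :: "real \<Rightarrow> (real \<Rightarrow> 'a) \<Rightarrow> (real \<Rightarrow> 'a) \<Rightarrow> real \<Rightarrow> 'a" where
  "concat_input S u v t = (if t < S then u t else v (t - S))"

lemma concat_in_input_ball:
  assumes "u \<in> input_ball s" "v \<in> input_ball s"
  shows "concat_input S u v \<in> input_ball s"
proof -
  have "(\<lambda>t. v (- S + t)) \<in> input_ball s" using shift_in_input_ball[OF assms(2)] .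
  then have [measurable]: "u \<in> borel_measurable lebesgue" "(\<lambda>t. v (t - S)) \<in> borel_measurable lebesgue"
    using assms by (auto simp: input_ball_def)
  have "concat_input S u v \<in> borel_measurable lebesgue"
    unfolding concat_input_def[abs_def] by (intro measurable_If) auto
  then show ?thesis using assms by (auto simp: input_ball_def concat_input_def)
qed

text \<open>The finite horizon is what lets a solution be cut, shifted and continued with another
  input.\<close>

definition solves_on ::
  "(real ^ 'n \<Rightarrow> real ^ 'm \<Rightarrow> real ^ 'n) \<Rightarrow> real ^ 'n \<Rightarrow> (real \<Rightarrow> real ^ 'm)
    \<Rightarrow> (real \<Rightarrow> real ^ 'n) \<Rightarrow> real \<Rightarrow> bool" where
  "solves_on f x u y T \<longleftrightarrow> (\<lambda>s. f (y s) (u s)) absolutely_integrable_on {0..T} \<and>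
     (\<forall>t\<in>{0..T}. y t = x + integral {0..t} (\<lambda>s. f (y s) (u s)))"

lemma is_solution_iff_solves_on: "is_solution f x u y \<longleftrightarrow> (\<forall>T\<ge>0. solves_on f x u y T)"
  by (auto simp: is_solution_def solves_on_def)

lemma solves_on_initial: "solves_on f x u y T \<Longrightarrow> T \<ge> 0 \<Longrightarrow> y 0 = x"
  by (auto simp: solves_on_def)

lemma solves_on_mono: "solves_on f x u y T \<Longrightarrow> t \<le> T \<Longrightarrow> solves_on f x u y t"
  by (auto simp: solves_on_def intro: absolutely_integrable_on_subinterval)

lemma solves_on_continuous:
  assumes "solves_on f x u y T"
  shows "continuous_on {0..T} y"
proof -
  have "continuous_on {0..T} (\<lambda>t. x + integral {0..t} (\<lambda>s. f (y s) (u s)))"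
    using assms by (intro continuous_intros indefinite_integral_continuous_1)
      (auto simp: solves_on_def absolutely_integrable_on_def)
  then show ?thesis
    using assms by (subst continuous_on_cong[OF refl]) (auto simp: solves_on_def)
qed

lemma solves_on_increment:
  assumes "solves_on f x u y T" "0 \<le> a" "a \<le> b" "b \<le> T"
  shows "y b = y a + integral {a..b} (\<lambda>s. f (y s) (u s))"
proof -
  have "(\<lambda>s. f (y s) (u s)) integrable_on {0..b}"
    using solves_on_mono[OF assms(1,4)] by (simp add: solves_on_def absolutely_integrable_on_def)
  from Henstock_Kurzweil_Integration.integral_combine[OF assms(2,3) this] show ?thesis
    using assms by (simp add: solves_on_def)
qed

lemma solves_on_cong:
  assumes "solves_on f x u y T" and N: "negligible N" and eq: "\<And>t. t \<in> {0..T} - N \<Longrightarrow> v t = u t"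
  shows "solves_on f x v y T"
proof -
  have "integral {0..t} (\<lambda>s. f (y s) (v s)) = integral {0..t} (\<lambda>s. f (y s) (u s))" if "t \<in> {0..T}" for t
    by (rule integral_spike[OF N]) (use eq that in auto)
  moreover have "(\<lambda>s. f (y s) (v s)) absolutely_integrable_on {0..T}"
    by (rule absolutely_integrable_spike[where f = "\<lambda>s. f (y s) (u s)", OF _ N])
      (use assms(1) eq in \<open>auto simp: solves_on_def\<close>)
  ultimately show ?thesis using assms(1) by (simp add: solves_on_def)
qed

lemma solves_on_shift:
  assumes "solves_on f x u y (S + T)" "S \<ge> 0" "T \<ge> 0"
  shows "solves_on f (y S) (\<lambda>t. u (S + t)) (\<lambda>t. y (S + t)) T"
proof -
  let ?g = "\<lambda>s. f (y s) (u s)"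
  have "?g absolutely_integrable_on {S..S + T}"
    using assms by (auto simp: solves_on_def intro: absolutely_integrable_on_subinterval)
  then have "?g integrable_on {S..S + T}" "(\<lambda>s. norm (?g s)) integrable_on {S..S + T}"
    by (auto simp: absolutely_integrable_on_def)
  from this[THEN integrable_shift_real_ivl, of S]
  have "(\<lambda>s. ?g (S + s)) absolutely_integrable_on {0..T}"
    by (intro absolutely_integrable_onI) (simp_all add: add.commute)
  moreover have "y (S + t) = y S + integral {0..t} (\<lambda>s. ?g (S + s))" if "t \<in> {0..T}" for t
    using solves_on_increment[OF assms(1), of S "S + t"] integral_shift_real_ivl[of S S "S + t" ?g] that assms
    by (simp add: add.commute)
  ultimately show ?thesis by (simp add: solves_on_def)
qed

section \<open>The flow and its dependence on inputs and initial states\<close>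

locale control_system =
  fixes f :: "real ^ 'n \<Rightarrow> real ^ 'm \<Rightarrow> real ^ 'n"
  assumes lip: "local_lipschitz UNIV UNIV (\<lambda>u x. f x u)"
    and complete: "forward_complete f"
begin

lemma lipschitz_state:
  obtains L where "L \<ge> 0"
    and "\<And>v x y. norm v \<le> s \<Longrightarrow> norm x \<le> R \<Longrightarrow> norm y \<le> R \<Longrightarrow> norm (f x v - f y v) \<le> L * norm (x - y)"
proof -
  obtain L where L: "\<forall>v\<in>cball 0 s. L-lipschitz_on (cball 0 R) (\<lambda>x. f x v)"
    using local_lipschitz_compact_convex_uniform[OF lip, of "cball 0 s" "cball 0 R"] by auto
  show ?thesis
  proof
    show "0 \<le> \<bar>L\<bar>" by simp
    fix v :: "real ^ 'm" and x y :: "real ^ 'n"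
    assume "norm v \<le> s" "norm x \<le> R" "norm y \<le> R"
    then have "norm (f x v - f y v) \<le> L * norm (x - y)"
      using L lipschitz_onD[of L "cball 0 R" "\<lambda>x. f x v" x y] by (simp add: dist_norm)
    also have "\<dots> \<le> \<bar>L\<bar> * norm (x - y)" by (intro mult_right_mono) auto
    finally show "norm (f x v - f y v) \<le> \<bar>L\<bar> * norm (x - y)" .
  qed
qed

text \<open>Under a common input the difference of the integrands is at most \<open>L\<close> times
  the distance of the trajectories, so both Gronwall inequalities apply. The second bound limits how
  fast trajectories can merge.\<close>

lemma solution_separation:
  assumes y: "solves_on f x1 u y1 T" "solves_on f x2 u y2 T" and u: "\<And>t. norm (u t) \<le> s" and "T \<ge> 0"
    and R: "\<And>t. t \<in> {0..T} \<Longrightarrow> norm (y1 t) \<le> R \<and> norm (y2 t) \<le> R"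
    and L: "L \<ge> 0" "\<And>v x y. norm v \<le> s \<Longrightarrow> norm x \<le> R \<Longrightarrow> norm y \<le> R \<Longrightarrow> norm (f x v - f y v) \<le> L * norm (x - y)"
  shows "norm (y1 T - y2 T) \<le> exp (L * T) * norm (x1 - x2)"
    and "norm (x1 - x2) \<le> exp (L * T) * norm (y1 T - y2 T)"
proof -
  have c: "continuous_on {0..T} (\<lambda>t. norm (y1 t - y2 t))"
    using y[THEN solves_on_continuous] by (intro continuous_intros)
  have *: "norm ((y1 b - y2 b) - (y1 a - y2 a)) \<le> L * integral {a..b} (\<lambda>t. norm (y1 t - y2 t))"
    if "0 \<le> a" "a \<le> b" "b \<le> T" for a b
  proof -
    have i: "(\<lambda>s. f (y1 s) (u s)) integrable_on {a..b}" "(\<lambda>s. f (y2 s) (u s)) integrable_on {a..b}"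
      using y that by (auto simp: solves_on_def absolutely_integrable_on_def intro: integrable_subinterval_real)
    have "(y1 b - y2 b) - (y1 a - y2 a) = integral {a..b} (\<lambda>s. f (y1 s) (u s) - f (y2 s) (u s))"
      using solves_on_increment[OF y(1) that] solves_on_increment[OF y(2) that]
      by (simp add: integral_diff[OF i])
    also have "norm \<dots> \<le> integral {a..b} (\<lambda>t. L * norm (y1 t - y2 t))"
    proof (rule integral_norm_bound_integral)
      show "(\<lambda>s. f (y1 s) (u s) - f (y2 s) (u s)) integrable_on {a..b}" by (rule integrable_diff[OF i])
      show "(\<lambda>t. L * norm (y1 t - y2 t)) integrable_on {a..b}"
        by (intro integrable_continuous_interval continuous_on_mult continuous_on_const
            continuous_on_subset[OF c]) (use that in auto)
    qed (use that R u in \<open>auto intro!: L(2)\<close>)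
    finally show ?thesis by simp
  qed
  have init: "y1 0 = x1" "y2 0 = x2" using y[THEN solves_on_initial] \<open>T \<ge> 0\<close> by auto
  show "norm (y1 T - y2 T) \<le> exp (L * T) * norm (x1 - x2)"
  proof (rule Gronwall_forward[OF c L(1)])
    fix t assume "t \<in> {0..T}"
    then show "norm (y1 t - y2 t) \<le> norm (x1 - x2) + L * integral {0..t} (\<lambda>t. norm (y1 t - y2 t))"
      using *[of 0 t] norm_triangle_sub[of "y1 t - y2 t" "x1 - x2"] by (simp add: init)
  qed (use \<open>T \<ge> 0\<close> in auto)
  have "norm (y1 0 - y2 0) \<le> exp (L * T) * norm (y1 T - y2 T)"
  proof (rule Gronwall_backward[OF c L(1) \<open>T \<ge> 0\<close>])
    fix t assume "t \<in> {0..T}"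
    then show "norm (y1 t - y2 t) \<le> norm (y1 T - y2 T) + L * integral {t..T} (\<lambda>t. norm (y1 t - y2 t))"
      using *[of t T] norm_triangle_sub[of "y1 t - y2 t" "y1 T - y2 T"]
      by (simp add: norm_minus_commute)
  qed
  then show "norm (x1 - x2) \<le> exp (L * T) * norm (y1 T - y2 T)" by (simp add: init)
qed

lemma solves_on_unique:
  assumes y: "solves_on f x u y1 T" "solves_on f x u y2 T" and u: "u \<in> input_ball s" and t: "t \<in> {0..T}"
  shows "y1 t = y2 t"
proof -
  have "bounded (y1 ` {0..T} \<union> y2 ` {0..T})"
    using y[THEN solves_on_continuous] by (auto intro!: compact_imp_bounded compact_continuous_image)
  then obtain R where R: "\<And>z. z \<in> y1 ` {0..T} \<union> y2 ` {0..T} \<Longrightarrow> norm z \<le> R"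
    by (auto simp: bounded_iff)
  obtain L where L: "L \<ge> 0"
    "\<And>v x y. norm v \<le> s \<Longrightarrow> norm x \<le> R \<Longrightarrow> norm y \<le> R \<Longrightarrow> norm (f x v - f y v) \<le> L * norm (x - y)"
    using lipschitz_state[of s R] by blast
  have "norm (y1 t - y2 t) \<le> exp (L * t) * norm (x - x)"
  proof (rule solution_separation(1))
    show "solves_on f x u y1 t" "solves_on f x u y2 t" using y t by (auto intro: solves_on_mono)
    show "norm (u r) \<le> s" for r using u by (simp add: input_ball_def)
    show "norm (y1 r) \<le> R \<and> norm (y2 r) \<le> R" if "r \<in> {0..t}" for r using that t by (auto intro!: R)
  qed (use t L in auto)
  then show ?thesis by simp
qed

lemma flow_eqI:
  assumes y: "is_solution f x u y" and u: "u \<in> input_ball s" and "t \<ge> 0"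
  shows "flow f t x u = y t"
  unfolding flow_def
proof (rule the_equality)
  show "\<exists>y'. is_solution f x u y' \<and> y' t = y t" using y by blast
  fix z assume "\<exists>y'. is_solution f x u y' \<and> y' t = z"
  then obtain y' where y': "is_solution f x u y'" "z = y' t" by blast
  have "solves_on f x u y' t" "solves_on f x u y t"
    using y y' \<open>t \<ge> 0\<close> by (simp_all add: is_solution_iff_solves_on)
  from solves_on_unique[OF this u, of t] show "z = y t" using y' \<open>t \<ge> 0\<close> by simp
qed

lemma flow_solves_on:
  assumes u: "u \<in> input_ball s"
  shows "solves_on f x u (\<lambda>t. flow f t x u) T"
proof -
  obtain y where y: "is_solution f x u y"
    using complete u input_ball_subset_inputs unfolding forward_complete_def by blast
  have eq: "flow f t x u = y t" if "t \<ge> 0" for t using flow_eqI[OF y u that] .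
  show ?thesis
  proof (cases "T \<ge> 0")
    case True
    have "solves_on f x u y T" using y True by (simp add: is_solution_iff_solves_on)
    moreover have "integral {0..t} (\<lambda>s. f (flow f s x u) (u s)) = integral {0..t} (\<lambda>s. f (y s) (u s))" for t
      by (rule integral_cong) (simp add: eq)
    moreover have "(\<lambda>s. f (flow f s x u) (u s)) absolutely_integrable_on {0..T} \<longleftrightarrow>
        (\<lambda>s. f (y s) (u s)) absolutely_integrable_on {0..T}"
      by (rule absolutely_integrable_spike_eq[of "{}"]) (simp_all add: eq)
    ultimately show ?thesis by (simp add: solves_on_def eq)
  qed (simp add: solves_on_def)
qed

lemma flow_eq:
  assumes "solves_on f x u y T" "u \<in> input_ball s" "0 \<le> T"
  shows "flow f T x u = y T"
  by (rule solves_on_unique[OF flow_solves_on[OF assms(2)] assms(1,2)]) (use assms in auto)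

lemma flow_0: "u \<in> input_ball s \<Longrightarrow> flow f 0 x u = x"
  using solves_on_initial[OF flow_solves_on[of u s x 0]] by simp

lemma flow_continuous: "u \<in> input_ball s \<Longrightarrow> continuous_on {0..T} (\<lambda>t. flow f t x u)"
  by (rule solves_on_continuous[OF flow_solves_on])

lemma flow_bounded:
  assumes "u \<in> input_ball s"
  obtains R where "\<And>t. t \<in> {0..T} \<Longrightarrow> norm (flow f t x u) \<le> R"
proof -
  have "bounded ((\<lambda>t. flow f t x u) ` {0..T})"
    using flow_continuous[OF assms] by (intro compact_imp_bounded compact_continuous_image) auto
  then show ?thesis using that unfolding bounded_iff by blast
qed

lemma flow_causal:
  assumes "u \<in> input_ball s" "v \<in> input_ball s" "\<And>t. 0 \<le> t \<Longrightarrow> t < T \<Longrightarrow> u t = v t" "0 \<le> T"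
  shows "flow f T x u = flow f T x v"
proof (rule flow_eq[OF _ assms(1,4)])
  show "solves_on f x u (\<lambda>t. flow f t x v) T"
  proof (rule solves_on_cong[OF flow_solves_on[OF assms(2)]])
    \<comment> \<open>The hypothesis only covers \<open>t < T\<close>. The single time
      \<open>T\<close> matters because \<open>concat_input\<close> uses the second input already at
      the switching time.\<close>
    show "negligible {T}" by simp
    show "u t = v t" if "t \<in> {0..T} - {T}" for t by (rule assms(3)) (use that in auto)
  qed
qed

lemma flow_shift:
  assumes "u \<in> input_ball s" "0 \<le> S" "0 \<le> t"
  shows "flow f (S + t) x u = flow f t (flow f S x u) (\<lambda>r. u (S + r))"
proof -
  let ?v = "\<lambda>r. u (S + r)"
  have "solves_on f (flow f S x u) ?v (\<lambda>r. flow f (S + r) x u) t"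
    using solves_on_shift[OF flow_solves_on[OF assms(1)] assms(2,3)] .
  from flow_eq[OF this shift_in_input_ball[OF assms(1)] assms(3)] show ?thesis by simp
qed

lemma flow_concat_before:
  assumes "u \<in> input_ball s" "v \<in> input_ball s" "0 \<le> t" "t \<le> S"
  shows "flow f t x (concat_input S u v) = flow f t x u"
  by (rule flow_causal[OF concat_in_input_ball[OF assms(1,2)] assms(1)])
    (use assms(3,4) in \<open>auto simp: concat_input_def\<close>)

lemma flow_concat_after:
  assumes "u \<in> input_ball s" "v \<in> input_ball s" "0 \<le> t" "0 \<le> S"
  shows "flow f (S + t) x (concat_input S u v) = flow f t (flow f S x u) v"
proof -
  let ?w = "concat_input S u v"
  have w: "?w \<in> input_ball s" by (rule concat_in_input_ball[OF assms(1,2)])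
  have "flow f (S + t) x ?w = flow f t (flow f S x ?w) (\<lambda>r. ?w (S + r))" by (rule flow_shift[OF w assms(4,3)])
  also have "flow f S x ?w = flow f S x u" by (rule flow_concat_before[OF assms(1,2)]) (use assms in auto)
  also have "flow f t (flow f S x u) (\<lambda>r. ?w (S + r)) = flow f t (flow f S x u) v"
    by (rule flow_causal[OF shift_in_input_ball[OF w] assms(2)]) (simp_all add: concat_input_def assms)
  finally show ?thesis .
qed

lemma flow_input_cong:
  assumes "negligible N" "\<And>t. t \<in> {0..} - N \<Longrightarrow> v t = u t"
  shows "flow f t x u = flow f t x v"
proof -
  have "is_solution f x u y \<longleftrightarrow> is_solution f x v y" for y
    unfolding is_solution_iff_solves_on
  proof (intro iff_allI imp_cong refl iffI)
    fix T assume "solves_on f x u y T"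
    then show "solves_on f x v y T" by (rule solves_on_cong[OF _ assms(1)]) (simp add: assms(2))
  next
    fix T assume "solves_on f x v y T"
    then show "solves_on f x u y T" by (rule solves_on_cong[OF _ assms(1)]) (simp add: assms(2))
  qed
  then show ?thesis by (simp add: flow_def)
qed

lemma flow_input_ball:
  assumes "u \<in> inputs" "input_norm u \<le> s"
  obtains v where "v \<in> input_ball s" "\<And>t x. flow f t x u = flow f t x v"
  using inputs_ae_eq_input_ball[OF assms] flow_input_cong by metis


text \<open>Continuation argument: \<open>L\<close> is valid only in the ball of radius
  \<open>R + 1\<close>, which the second trajectory cannot leave while its distance from the first
  is at most 1. At the first time with distance 1, the Gronwall bound up to then would already make
  the distance less than 1.\<close>

lemma flow_close:
  assumes u: "u \<in> input_ball s" and R: "\<And>t. t \<in> {0..T} \<Longrightarrow> norm (flow f t x u) \<le> R"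
    and L: "L \<ge> 0" "\<And>v x y. norm v \<le> s \<Longrightarrow> norm x \<le> R + 1 \<Longrightarrow> norm y \<le> R + 1 \<Longrightarrow>
      norm (f x v - f y v) \<le> L * norm (x - y)"
    and x': "exp (L * T) * norm (x - x') < 1" and t: "t \<in> {0..T}"
  shows "norm (flow f t x u - flow f t x' u) \<le> exp (L * t) * norm (x - x')"
    and "norm (x - x') \<le> exp (L * t) * norm (flow f t x u - flow f t x' u)"
proof -
  define g where "g = (\<lambda>t. norm (flow f t x u - flow f t x' u))"
  have R': "norm (flow f r x u) \<le> R + 1 \<and> norm (flow f r x' u) \<le> R + 1" if "r \<in> {0..T}" "g r \<le> 1" for r
    using norm_triangle_sub[of "flow f r x' u" "flow f r x u"] R[of r] that
    by (simp add: g_def norm_minus_commute)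
  have u': "norm (u r) \<le> s" for r using u by (simp add: input_ball_def)
  have g1: "g t \<le> 1" if t: "t \<in> {0..T}" for t
  proof (rule ccontr)
    assume "\<not> g t \<le> 1"
    moreover have "norm (x - x') \<le> exp (L * T) * norm (x - x')"
      using L(1) t by (intro mult_le_cancel_right1[THEN iffD2]) auto
    then have "g 0 \<le> 1" using x' by (simp add: g_def flow_0[OF u])
    moreover have "continuous_on {0..t} g"
      unfolding g_def by (intro continuous_intros flow_continuous[OF u])
    ultimately obtain r where r: "r \<in> {0..t}" "g r = 1" "\<And>q. q \<in> {0..r} \<Longrightarrow> g q \<le> 1"
      using first_hitting_time[of t g 1] t by (metis atLeastAtMost_iff nle_le)
    have "g r \<le> exp (L * r) * norm (x - x')"
      unfolding g_def
      by (rule solution_separation(1)[OF flow_solves_on[OF u] flow_solves_on[OF u] u' _ _ L])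
        (use r t R' in auto)
    also have "\<dots> \<le> exp (L * T) * norm (x - x')"
      using r t L(1) by (intro mult_right_mono) (auto intro!: mult_left_mono)
    finally show False using x' r by simp
  qed
  have "\<And>r. r \<in> {0..t} \<Longrightarrow> norm (flow f r x u) \<le> R + 1 \<and> norm (flow f r x' u) \<le> R + 1"
    using t g1 by (intro R') auto
  note * = solution_separation[OF flow_solves_on[OF u] flow_solves_on[OF u] u' _ this L]
  show "norm (flow f t x u - flow f t x' u) \<le> exp (L * t) * norm (x - x')"
    and "norm (x - x') \<le> exp (L * t) * norm (flow f t x u - flow f t x' u)"
    by (rule *; use t in simp)+
qed

lemma flow_uniformly_continuous_initial:
  assumes u: "u \<in> input_ball s" and "\<eta> > 0"
  obtains \<delta> where "\<delta> > 0" "\<And>x' t. dist x x' \<le> \<delta> \<Longrightarrow> t \<in> {0..T} \<Longrightarrow> dist (flow f t x u) (flow f t x' u) \<le> \<eta>"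
proof -
  obtain R where R: "\<And>t. t \<in> {0..T} \<Longrightarrow> norm (flow f t x u) \<le> R" using flow_bounded[OF u, where T = T and x = x] by blast
  obtain L where L: "L \<ge> 0" "\<And>v x y. norm v \<le> s \<Longrightarrow> norm x \<le> R + 1 \<Longrightarrow> norm y \<le> R + 1 \<Longrightarrow>
      norm (f x v - f y v) \<le> L * norm (x - y)"
    using lipschitz_state[of s "R + 1"] by blast
  \<comment> \<open>The bound 1/2 keeps the product strictly below 1, as \<open>flow_close\<close>
    requires.\<close>
  define \<delta> where "\<delta> = min \<eta> (1 / 2) / exp (L * T)"
  show ?thesis
  proof
    show "\<delta> > 0" using assms by (simp add: \<delta>_def)
    fix x' t assume x': "dist x x' \<le> \<delta>" and t: "t \<in> {0..T}"
    have *: "exp (L * T) * norm (x - x') \<le> min \<eta> (1 / 2)"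
      using x' by (simp add: \<delta>_def dist_norm field_simps)
    then have "exp (L * T) * norm (x - x') < 1" by linarith
    from flow_close(1)[OF u R L this t]
    have "dist (flow f t x u) (flow f t x' u) \<le> exp (L * t) * norm (x - x')" by (simp add: dist_norm)
    also have "\<dots> \<le> exp (L * T) * norm (x - x')"
      using t L(1) by (intro mult_right_mono) (auto intro!: mult_left_mono)
    finally show "dist (flow f t x u) (flow f t x' u) \<le> \<eta>" using * by linarith
  qed
qed

lemma flow_continuous_initial:
  assumes u: "u \<in> input_ball s" and "0 \<le> t"
  shows "continuous_on UNIV (\<lambda>x. flow f t x u)"
  unfolding continuous_on_iff
proof safe
  fix x and e :: real assume "e > 0"
  then obtain \<delta> where \<delta>: "\<delta> > 0"
      "\<And>x' r. dist x x' \<le> \<delta> \<Longrightarrow> r \<in> {0..t} \<Longrightarrow> dist (flow f r x u) (flow f r x' u) \<le> e / 2"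
    using flow_uniformly_continuous_initial[OF u, of "e / 2" x t] by auto
  have "dist (flow f t x' u) (flow f t x u) < e" if "dist x' x < \<delta>" for x'
    using \<delta>(2)[of x' t] that \<open>0 \<le> t\<close> \<open>e > 0\<close> by (simp add: dist_commute)
  then show "\<exists>d>0. \<forall>x'\<in>UNIV. dist x' x < d \<longrightarrow> dist (flow f t x' u) (flow f t x u) < e"
    using \<delta>(1) by blast
qed

lemma flow_two_bounded:
  assumes u: "u \<in> input_ball s" and "T \<ge> 0"
    and R: "\<And>t. t \<in> {0..T} \<Longrightarrow> norm (flow f t x u) \<le> R" "\<And>t. t \<in> {0..T} \<Longrightarrow> norm (flow f t x' u) \<le> R"
    and L: "L \<ge> 0" "\<And>v x y. norm v \<le> s \<Longrightarrow> norm x \<le> R \<Longrightarrow> norm y \<le> R \<Longrightarrow>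
      norm (f x v - f y v) \<le> L * norm (x - y)"
  shows "norm (flow f T x u - flow f T x' u) \<le> exp (L * T) * norm (x - x')"
    and "norm (x - x') \<le> exp (L * T) * norm (flow f T x u - flow f T x' u)"
  by (rule solution_separation[OF flow_solves_on[OF u] flow_solves_on[OF u] _ \<open>T \<ge> 0\<close> _ L];
      use u R in \<open>simp add: input_ball_def\<close>)+

lemma flow_inj:
  assumes u: "u \<in> input_ball s" and "0 \<le> t"
  shows "inj (\<lambda>x. flow f t x u)"
proof (rule injI)
  fix x y assume eq: "flow f t x u = flow f t y u"
  obtain R1 where R1: "\<And>r. r \<in> {0..t} \<Longrightarrow> norm (flow f r x u) \<le> R1"
    using flow_bounded[OF u, where T = t and x = x] by blast
  obtain R2 where R2: "\<And>r. r \<in> {0..t} \<Longrightarrow> norm (flow f r y u) \<le> R2"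
    using flow_bounded[OF u, where T = t and x = y] by blast
  obtain L where L: "L \<ge> 0" "\<And>v x y. norm v \<le> s \<Longrightarrow> norm x \<le> max R1 R2 \<Longrightarrow> norm y \<le> max R1 R2 \<Longrightarrow>
      norm (f x v - f y v) \<le> L * norm (x - y)"
    using lipschitz_state[of s "max R1 R2"] by blast
  have "norm (x - y) \<le> exp (L * t) * norm (flow f t x u - flow f t y u)"
    by (rule flow_two_bounded(2)[OF u \<open>0 \<le> t\<close> _ _ L]) (use R1 R2 in \<open>auto intro: max.coboundedI1 max.coboundedI2\<close>)
  then show "x = y" by (simp add: eq)
qed

lemma flow_open_map:
  assumes "u \<in> input_ball s" "0 \<le> t" "open S"
  shows "open ((\<lambda>x. flow f t x u) ` S)"
  by (rule invariance_of_domain[OF continuous_on_subset[OF flow_continuous_initial[OF assms(1,2)] subset_UNIV] assms(3)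
        inj_on_subset[OF flow_inj[OF assms(1,2)] subset_UNIV]])

text \<open>The radius depends on the input only through the bound \<open>R\<close> on the trajectory. The statement
  follows from the openness of the flow map and connectedness: the image of the sphere around
  \<open>x\<close> does not meet the smaller ball.\<close>

lemma flow_uniform_open_map:
  assumes u: "u \<in> input_ball s" and "0 \<le> T" and R: "\<And>t. t \<in> {0..T} \<Longrightarrow> norm (flow f t x u) \<le> R"
    and L: "L \<ge> 0" "\<And>v x y. norm v \<le> s \<Longrightarrow> norm x \<le> R + 1 \<Longrightarrow> norm y \<le> R + 1 \<Longrightarrow>
      norm (f x v - f y v) \<le> L * norm (x - y)"
    and e: "e > 0" "exp (L * T) * e < 1"
  shows "ball (flow f T x u) (e / exp (L * T)) \<subseteq> (\<lambda>x. flow f T x u) ` ball x e"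
proof -
  define P where "P = (\<lambda>x. flow f T x u)"
  define B where "B = ball (P x) (e / exp (L * T))"
  have op: "open (P ` ball x e)" unfolding P_def by (rule flow_open_map[OF u \<open>0 \<le> T\<close>]) simp
  have "compact (P ` cball x e)"
    unfolding P_def using flow_continuous_initial[OF u \<open>0 \<le> T\<close>]
    by (intro compact_continuous_image) (auto intro: continuous_on_subset)
  then have cl: "closed (P ` cball x e)" by (rule compact_imp_closed)
  have sph: "P y \<notin> B" if "dist x y = e" for y
  proof -
    have "exp (L * T) * norm (x - y) < 1" using that e by (simp add: dist_norm)
    from flow_close(2)[OF u R L this, of T] that \<open>0 \<le> T\<close>
    show ?thesis by (simp add: B_def P_def dist_norm field_simps)
  qed
  have "B \<subseteq> P ` ball x e \<union> - P ` cball x e" using sph by (force simp: less_le)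
  moreover have "P ` ball x e \<inter> - P ` cball x e \<inter> B = {}" by (auto simp: less_le)
  moreover have "connected B" by (simp add: B_def connected_ball)
  moreover have "P x \<in> P ` ball x e \<inter> B" using e by (simp add: B_def)
  ultimately have "- P ` cball x e \<inter> B = {}"
    using connectedD[OF _ op, of B "- P ` cball x e"] cl by (auto simp: open_Compl)
  then show ?thesis
    using \<open>B \<subseteq> _\<close> unfolding B_def P_def by blast
qed

end

section \<open>Shadowing\<close>

text \<open>\<open>S\<close> may stay bounded, as it does when escape in finite time is refuted, so
  \<open>v\<close> needs a value after all \<open>S j\<close>; it is 0 there. The truncations
  \<open>z j\<close> converge to \<open>v\<close> pointwise, whence measurability.\<close>

lemma limit_input:
  fixes w :: "nat \<Rightarrow> real \<Rightarrow> real ^ 'm" and S :: "nat \<Rightarrow> real"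
  assumes w: "\<And>j. w j \<in> input_ball s" and "mono S" and eq: "\<And>j t. t < S j \<Longrightarrow> w (Suc j) t = w j t"
  obtains v where "v \<in> input_ball s" "\<And>j t. t < S j \<Longrightarrow> v t = w j t"
proof -
  have const: "w k t = w j t" if "t < S j" "j \<le> k" for j k t
    using that(2)
  proof (induction rule: dec_induct)
    case (step i)
    have "t < S i" using that(1) monoD[OF \<open>mono S\<close> step(1)] by simp
    then show ?case using eq[of t i] step.IH by simp
  qed (rule refl)
  define z where "z = (\<lambda>j t. if t < S j then w j t else 0)"
  define v where "v = (\<lambda>t. if \<exists>j. t < S j then w (LEAST j. t < S j) t else 0)"
  have v: "v t = w j t" if "t < S j" for j t
  proof -
    have "t < S (LEAST j. t < S j)" using that by (rule LeastI)
    moreover have "(LEAST j. t < S j) \<le> j" using that by (rule Least_le)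
    ultimately have "w j t = w (LEAST j. t < S j) t" by (rule const)
    then show ?thesis using that unfolding v_def by metis
  qed
  have "z j \<in> borel_measurable lebesgue" for j
  proof -
    have [measurable]: "w j \<in> borel_measurable lebesgue" using w by (simp add: input_ball_def)
    show ?thesis unfolding z_def by (intro measurable_If) auto
  qed
  moreover have "(\<lambda>j. z j t) \<longlonglongrightarrow> v t" for t
  proof (cases "\<exists>j. t < S j")
    case True
    then obtain j where j: "t < S j" by blast
    have "z k t = v t" if "k \<ge> j" for k
      using v[of t k] j monoD[OF \<open>mono S\<close> that] by (simp add: z_def)
    then show ?thesis by (intro tendsto_eventually) (auto simp: eventually_sequentially)
  next
    case False
    then show ?thesis by (simp add: z_def v_def)
  qed
  ultimately have "v \<in> borel_measurable lebesgue" by (rule borel_measurable_LIMSEQ_metric)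
  \<comment> \<open>Evaluation at any time whatsoever yields \<open>0 \<le> s\<close>, which the
    default value 0 of \<open>v\<close> requires.\<close>
  moreover have "norm (w 0 undefined) \<le> s" using w[of 0] by (simp add: input_ball_def)
  then have "0 \<le> s" by (rule order_trans[OF norm_ge_zero])
  then have "norm (v t) \<le> s" for t using w by (auto simp: v_def input_ball_def)
  ultimately show ?thesis using that v by (auto simp: input_ball_def)
qed

context control_system begin

text \<open>Two pullbacks are combined. Openness of the flow along the new piece moves its start
  from \<open>x\<close> to a point \<open>x'\<close> whose trajectory ends at \<open>loc b\<close>
  exactly, and openness of the flow up to time \<open>S\<close> moves \<open>q\<close> to a
  \<open>q'\<close> that arrives at \<open>x'\<close>. The predicate \<open>G\<close> is only
  carried along; it lets one step serve different kinds of pieces.\<close>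

lemma shadowing_step:
  assumes w: "w \<in> input_ball s" and "S \<ge> 0" "r > 0" and p: "flow f S q w = p"
    and step: "\<And>\<epsilon>. \<epsilon> > 0 \<Longrightarrow> \<exists>x u \<sigma> b. G x u \<sigma> b \<and> u \<in> input_ball s \<and> 0 \<le> \<sigma> \<and> \<sigma> \<le> \<Sigma> \<and>
      dist x p < \<epsilon> \<and> dist (flow f \<sigma> x u) (loc b) < \<epsilon> \<and> (\<forall>t\<in>{0..\<sigma>}. norm (flow f t x u) \<le> R)"
  shows "\<exists>b q' r' w' S'. r' > 0 \<and> w' \<in> input_ball s \<and> S \<le> S' \<and> flow f S' q' w' = loc b \<and>
    cball q' r' \<subseteq> cball q r \<and> (\<forall>t<S. w' t = w t) \<and>
    (\<exists>x u. G x u (S' - S) b \<and> u \<in> input_ball s \<and>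
      (\<forall>q''\<in>cball q' r'. \<forall>t\<in>{0..S' - S}. dist (flow f (S + t) q'' w') (flow f t x u) \<le> 1))"
proof -
  obtain L where L: "L \<ge> 0" "\<And>v x y. norm v \<le> s \<Longrightarrow> norm x \<le> R + 1 \<Longrightarrow> norm y \<le> R + 1 \<Longrightarrow>
      norm (f x v - f y v) \<le> L * norm (x - y)"
    using lipschitz_state[of s "R + 1"] by blast
  have "open ((\<lambda>x. flow f S x w) ` ball q r)" by (rule flow_open_map[OF w \<open>S \<ge> 0\<close>]) simp
  moreover have "p \<in> (\<lambda>x. flow f S x w) ` ball q r" using p \<open>r > 0\<close> by force
  ultimately obtain \<rho> where \<rho>: "\<rho> > 0" "ball p \<rho> \<subseteq> (\<lambda>x. flow f S x w) ` ball q r"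
    by (meson open_contains_ball)
  define E where "E = exp (L * \<Sigma>)"
  \<comment> \<open>Half of \<open>\<rho>\<close> leaves room for the two moves from
    \<open>p\<close> to \<open>x\<close> and from \<open>x\<close> to \<open>x'\<close>; the other
    bound keeps the deviation over a piece of length at most \<open>\<Sigma>\<close> below
    1/2.\<close>
  define e where "e = min (\<rho> / 2) (1 / (2 * E))"
  have E: "E > 0" by (simp add: E_def)
  then have e: "e > 0" "e \<le> \<rho> / 2" "E * e \<le> 1 / 2" using \<rho>(1) by (auto simp: e_def min_def field_simps)
  \<comment> \<open>The tolerance \<open>e / E\<close> fits into the radius
    \<open>e / exp (L * \<sigma>)\<close> of \<open>flow_uniform_open_map\<close>, whatever the
    length \<open>\<sigma> \<le> \<Sigma>\<close> turns out to be.\<close>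
  obtain x u \<sigma> b where G: "G x u \<sigma> b" and u: "u \<in> input_ball s" and \<sigma>: "0 \<le> \<sigma>" "\<sigma> \<le> \<Sigma>"
    and x: "dist x p < min e (e / E)" and b: "dist (flow f \<sigma> x u) (loc b) < min e (e / E)"
    and R: "\<And>t. t \<in> {0..\<sigma>} \<Longrightarrow> norm (flow f t x u) \<le> R"
    using step[of "min e (e / E)"] e(1) E by auto
  have E\<sigma>: "exp (L * t) \<le> E" if "t \<le> \<sigma>" for t
    unfolding E_def using L(1) \<sigma> that by (simp add: mult_left_mono)
  then have E\<sigma>e: "exp (L * t) * e \<le> 1 / 2" if "t \<le> \<sigma>" for t
    using e that by (meson mult_right_mono order_less_imp_le order_trans)
  have "loc b \<in> ball (flow f \<sigma> x u) (e / exp (L * \<sigma>))"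
    using b E\<sigma>[of \<sigma>] e(1) E divide_left_mono[of "exp (L * \<sigma>)" E e] by simp
  moreover have "exp (L * \<sigma>) * e < 1" using E\<sigma>e[of \<sigma>] by simp
  ultimately have "loc b \<in> (\<lambda>x. flow f \<sigma> x u) ` ball x e"
    using flow_uniform_open_map[OF u \<sigma>(1) R L e(1)] by blast
  then obtain x' where x': "dist x x' < e" "flow f \<sigma> x' u = loc b" by auto
  have close: "dist (flow f t x u) (flow f t x' u) \<le> 1 / 2" if t: "t \<in> {0..\<sigma>}" for t
  proof -
    have "exp (L * \<sigma>) * norm (x - x') \<le> exp (L * \<sigma>) * e"
      using x' by (intro mult_left_mono) (auto simp: dist_norm)
    also have "\<dots> < 1" using E\<sigma>e[of \<sigma>] by simp
    finally have "dist (flow f t x u) (flow f t x' u) \<le> exp (L * t) * norm (x - x')"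
      using flow_close(1)[OF u R L _ t] by (simp add: dist_norm)
    also have "\<dots> \<le> exp (L * t) * e" using x' by (intro mult_left_mono) (auto simp: dist_norm)
    finally show ?thesis using E\<sigma>e[of t] t by simp
  qed
  have "dist p x' < \<rho>"
    using dist_triangle[of p x' x] x x'(1) e(2) by (simp add: dist_commute)
  then obtain q' where q': "dist q q' < r" "flow f S q' w = x'" using \<rho>(2) by auto
  define w' where "w' = concat_input S w u"
  have w': "w' \<in> input_ball s" unfolding w'_def by (rule concat_in_input_ball[OF w u])
  have after: "flow f (S + t) q' w' = flow f t x' u" if "0 \<le> t" for t
    unfolding w'_def using flow_concat_after[OF w u that \<open>S \<ge> 0\<close>] q' by simp
  obtain \<delta> where \<delta>: "\<delta> > 0"
    "\<And>q'' t. dist q' q'' \<le> \<delta> \<Longrightarrow> t \<in> {0..S + \<sigma>} \<Longrightarrow> dist (flow f t q' w') (flow f t q'' w') \<le> 1 / 2"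
    using flow_uniformly_continuous_initial[OF w', of "1 / 2" q' "S + \<sigma>"] by auto
  \<comment> \<open>\<open>\<delta>\<close> keeps trajectories from the new ball within 1/2 of the
    one from \<open>q'\<close>, which is itself within 1/2 of the piece; the second term keeps the
    balls nested.\<close>
  define r' where "r' = min \<delta> (r - dist q q')"
  have "cball q' r' \<subseteq> cball q r"
  proof
    fix z assume "z \<in> cball q' r'"
    then show "z \<in> cball q r" using dist_triangle[of q z q'] by (simp add: r'_def)
  qed
  moreover have "dist (flow f (S + t) q'' w') (flow f t x u) \<le> 1" if "q'' \<in> cball q' r'" "t \<in> {0..\<sigma>}" for q'' t
  proof -
    have "dist (flow f (S + t) q' w') (flow f (S + t) q'' w') \<le> 1 / 2"
      using that \<open>S \<ge> 0\<close> by (intro \<delta>(2)) (auto simp: r'_def)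
    then show ?thesis
      using close[OF that(2)] after[of t] that(2) dist_triangle[of "flow f (S + t) q'' w'" "flow f t x u" "flow f t x' u"]
      by (simp add: dist_commute)
  qed
  moreover have "r' > 0" using \<delta>(1) q'(1) by (simp add: r'_def)
  moreover have "flow f (S + \<sigma>) q' w' = loc b" using after[OF \<sigma>(1)] x' by simp
  moreover have "\<forall>t<S. w' t = w t" by (simp add: w'_def concat_input_def)
  ultimately show ?thesis
    using w' \<sigma>(1) G u
    by (intro exI[of _ b] exI[of _ q'] exI[of _ r'] exI[of _ w'] exI[of _ "S + \<sigma>"] conjI exI[of _ x] exI[of _ u]) simp_all
qed

text \<open>A point \<open>b\<close> with \<open>B b\<close> records a location together with the information that
  allows one to continue from there; \<open>R\<close> and \<open>\<Sigma>\<close> must not depend on \<open>\<epsilon>\<close>, as \<open>\<epsilon>\<close> is chosen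
  from the Lipschitz constant that they determine.\<close>

lemma shadowing_chain:
  fixes B :: "'b \<Rightarrow> bool" and loc :: "'b \<Rightarrow> real ^ 'n"
    and Q :: "'b \<Rightarrow> real ^ 'n \<Rightarrow> (real \<Rightarrow> real ^ 'm) \<Rightarrow> real \<Rightarrow> 'b \<Rightarrow> bool"
  assumes "B b0" and "s \<ge> 0"
    and step: "\<And>b. B b \<Longrightarrow> \<exists>R \<Sigma>. \<forall>\<epsilon>>0. \<exists>x u \<sigma> b'. B b' \<and> Q b x u \<sigma> b' \<and> u \<in> input_ball s \<and> 0 \<le> \<sigma> \<and> \<sigma> \<le> \<Sigma> \<and>
      dist x (loc b) < \<epsilon> \<and> dist (flow f \<sigma> x u) (loc b') < \<epsilon> \<and> (\<forall>t\<in>{0..\<sigma>}. norm (flow f t x u) \<le> R)"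
  obtains S q w x u b where
    "\<And>j t. t \<in> {0..S (Suc j) - S j} \<Longrightarrow> dist (flow f (S j + t) q w) (flow f t (x j) (u j)) \<le> 1"
    "\<And>j. Q (b j) (x j) (u j) (S (Suc j) - S j) (b (Suc j))" "w \<in> input_ball s" "b 0 = b0" "S 0 = 0" "mono S"
    "\<And>j. B (b j)" "\<And>j. u j \<in> input_ball s"
proof -
  \<comment> \<open>\<open>I\<close>: the centre \<open>q\<close> reaches the current location
    exactly at time \<open>S\<close>. \<open>N\<close> keeps what survives in the limit: nested
    balls, an input frozen before \<open>S\<close>, and closeness to the piece for all points of the
    new ball.\<close>
  define I where "I = (\<lambda>(b, q, r :: real, w, S :: real). B b \<and> r > 0 \<and> w \<in> input_ball s \<and> S \<ge> 0 \<and> flow f S q w = loc b)"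
  define N where "N = (\<lambda>(b, q, r :: real, w, S :: real) (b', q', r' :: real, w', S' :: real). S \<le> S' \<and> cball q' r' \<subseteq> cball q r \<and> (\<forall>t<S. w' t = w t) \<and>
    (\<exists>x u. Q b x u (S' - S) b' \<and> u \<in> input_ball s \<and>
      (\<forall>q''\<in>cball q' r'. \<forall>t\<in>{0..S' - S}. dist (flow f (S + t) q'' w') (flow f t x u) \<le> 1)))"
  have zero: "(\<lambda>t. 0) \<in> input_ball s" using \<open>s \<ge> 0\<close> by (simp add: input_ball_def)
  define F0 where "F0 = (b0, loc b0, 1 :: real, (\<lambda>t. 0) :: real \<Rightarrow> real ^ 'm, 0 :: real)"
  have "\<exists>F. \<forall>n. (I (F n) \<and> (n = 0 \<longrightarrow> F n = F0)) \<and> N (F n) (F (Suc n))"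
  proof (rule dependent_nat_choice)
    show "\<exists>st. I st \<and> ((0::nat) = 0 \<longrightarrow> st = F0)"
      using \<open>B b0\<close> zero by (simp add: I_def F0_def flow_0[OF zero])
    fix st and n :: nat
    assume st: "I st \<and> (n = 0 \<longrightarrow> st = F0)"
    obtain b q r w S where st_eq: "st = (b, q, r, w, S)" by (cases st)
    have b: "B b" and r: "r > 0" and w: "w \<in> input_ball s" and S: "S \<ge> 0" and p: "flow f S q w = loc b"
      using st by (auto simp: I_def st_eq)
    obtain R \<Sigma> where "\<And>\<epsilon>. \<epsilon> > 0 \<Longrightarrow> \<exists>x u \<sigma> b'. (B b' \<and> Q b x u \<sigma> b') \<and> u \<in> input_ball s \<and> 0 \<le> \<sigma> \<and> \<sigma> \<le> \<Sigma> \<and>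
      dist x (loc b) < \<epsilon> \<and> dist (flow f \<sigma> x u) (loc b') < \<epsilon> \<and> (\<forall>t\<in>{0..\<sigma>}. norm (flow f t x u) \<le> R)"
      using step[OF b] unfolding conj_assoc by blast
    from shadowing_step[OF w S r p this]
    obtain b' q' r' w' S' x u where *: "r' > 0" "w' \<in> input_ball s" "S \<le> S'" "flow f S' q' w' = loc b'"
      "cball q' r' \<subseteq> cball q r" "\<forall>t<S. w' t = w t" "B b'" "Q b x u (S' - S) b'" "u \<in> input_ball s"
      "\<forall>q''\<in>cball q' r'. \<forall>t\<in>{0..S' - S}. dist (flow f (S + t) q'' w') (flow f t x u) \<le> 1"
      by blast
    then have "I (b', q', r', w', S')" "N (b, q, r, w, S) (b', q', r', w', S')"
      using S unfolding I_def N_def by auto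
    then show "\<exists>st'. (I st' \<and> (Suc n = 0 \<longrightarrow> st' = F0)) \<and> N st st'" unfolding st_eq by blast
  qed
  then obtain F where F: "\<And>n. I (F n)" "F 0 = F0" "\<And>n. N (F n) (F (Suc n))"
    by metis
  define b q r w S where "b = (\<lambda>n. fst (F n))" and "q = (\<lambda>n. fst (snd (F n)))" and "r = (\<lambda>n. fst (snd (snd (F n))))"
    and "w = (\<lambda>n. fst (snd (snd (snd (F n)))))" and "S = (\<lambda>n. snd (snd (snd (snd (F n)))))"
  have F_eq: "F n = (b n, q n, r n, w n, S n)" for n by (simp add: b_def q_def r_def w_def S_def)
  have I: "B (b n)" "r n > 0" "w n \<in> input_ball s" "S n \<ge> 0" for n using F(1)[of n] by (auto simp: I_def F_eq)
  have N: "S n \<le> S (Suc n)" "cball (q (Suc n)) (r (Suc n)) \<subseteq> cball (q n) (r n)" "\<And>t. t < S n \<Longrightarrow> w (Suc n) t = w n t"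
    "\<exists>x u. Q (b n) x u (S (Suc n) - S n) (b (Suc n)) \<and> u \<in> input_ball s \<and>
      (\<forall>q''\<in>cball (q (Suc n)) (r (Suc n)). \<forall>t\<in>{0..S (Suc n) - S n}. dist (flow f (S n + t) q'' (w (Suc n))) (flow f t x u) \<le> 1)"
    for n using F(3)[of n] by (auto simp: N_def F_eq)
  obtain x u where xu: "\<And>n. Q (b n) (x n) (u n) (S (Suc n) - S n) (b (Suc n))" "\<And>n. u n \<in> input_ball s"
      "\<And>n q'' t. q'' \<in> cball (q (Suc n)) (r (Suc n)) \<Longrightarrow> t \<in> {0..S (Suc n) - S n} \<Longrightarrow>
        dist (flow f (S n + t) q'' (w (Suc n))) (flow f t (x n) (u n)) \<le> 1"
    using N(4) by metis
  have S: "mono S" using N(1) by (simp add: mono_iff_le_Suc)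
  obtain v where v: "v \<in> input_ball s" "\<And>j t. t < S j \<Longrightarrow> v t = w j t"
    using limit_input[where w = w and S = S and s = s, OF I(3) S N(3)] by blast
  \<comment> \<open>The radii need not tend to 0: any point of the intersection will do, because the
    closeness in \<open>N\<close> holds on the whole ball.\<close>
  have "\<Inter>(range (\<lambda>n. cball (q n) (r n))) \<noteq> {}"
  proof (rule compact_nest)
    show "cball (q n) (r n) \<noteq> {}" for n using I(2)[of n] by simp
    show "cball (q n) (r n) \<subseteq> cball (q m) (r m)" if "m \<le> n" for m n
      by (rule lift_Suc_antimono_le[where f = "\<lambda>n. cball (q n) (r n)", OF N(2) that])
  qed simp
  then obtain z where z: "\<And>n. z \<in> cball (q n) (r n)" by blast
  show ?thesis
  proof (rule that[OF _ xu(1) v(1) _ _ S I(1) xu(2)])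
    show "b 0 = b0" "S 0 = 0" using F(2) by (simp_all add: b_def S_def F0_def)
    fix j t assume t: "t \<in> {0..S (Suc j) - S j}"
    have "flow f (S j + t) z v = flow f (S j + t) z (w (Suc j))"
      by (rule flow_causal[OF v(1) I(3)]) (use t v(2)[of _ "Suc j"] I(4)[of j] in auto)
    then show "dist (flow f (S j + t) z v) (flow f t (x j) (u j)) \<le> 1" using xu(3)[OF z t] by simp
  qed
qed

end

section \<open>Bounded reachable sets and uniform hitting times\<close>

lemma norm_le_infdist:
  assumes "A \<noteq> {}" "\<And>a. a \<in> A \<Longrightarrow> norm a \<le> M"
  shows "norm x \<le> infdist x A + M"
proof -
  have "norm x - M \<le> dist x a" if "a \<in> A" for a
    using assms(2)[OF that] norm_triangle_sub[of x a] by (simp add: dist_norm)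
  then have "norm x - M \<le> infdist x A"
    using assms(1) by (simp add: infdist_notempty cINF_greatest)
  then show ?thesis by simp
qed

context control_system begin

text \<open>If trajectories starting near \<open>p\<close> are unbounded up to time \<open>T\<close>, then so are those that start
  near a suitable \<open>p'\<close> one unit further out, in the remaining time. Iterating this produces
  a trajectory that escapes in finite time.\<close>

lemma exit_points_accumulate:
  assumes bad: "\<And>\<epsilon> R. \<epsilon> > 0 \<Longrightarrow> \<exists>x\<in>ball p \<epsilon>. \<exists>u\<in>input_ball s. \<exists>t\<in>{0..T}. R < norm (flow f t x u)"
    and "T < E"
  obtains p' where "norm p' = norm p + 1"
    "\<And>\<epsilon>. \<epsilon> > 0 \<Longrightarrow> \<exists>x u \<sigma>. \<exists>T' < E - \<sigma>. u \<in> input_ball s \<and> \<sigma> \<in> {0..T} \<and> dist x p < \<epsilon> \<and> dist (flow f \<sigma> x u) p' < \<epsilon> \<and>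
      (\<forall>t\<in>{0..\<sigma>}. norm (flow f t x u) \<le> norm p + 1) \<and>
      (\<forall>\<epsilon> R. \<epsilon> > 0 \<longrightarrow> (\<exists>x\<in>ball p' \<epsilon>. \<exists>u\<in>input_ball s. \<exists>t\<in>{0..T'}. R < norm (flow f t x u)))"
proof -
  \<comment> \<open>Escape beyond every bound is needed, not merely beyond
    \<open>norm p + 1\<close>: after the exit, the rest of the same trajectories shows that
    \<open>p'\<close> is bad as well.\<close>
  have "\<exists>x u t. dist x p < 1 / real (Suc k) \<and> u \<in> input_ball s \<and> t \<in> {0..T} \<and> norm p + 1 + real k < norm (flow f t x u)" for k
  proof -
    obtain x u t where "x \<in> ball p (1 / real (Suc k))" "u \<in> input_ball s" "t \<in> {0..T}"
      "norm p + 1 + real k < norm (flow f t x u)"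
      using bad[of "1 / real (Suc k)" "norm p + 1 + real k"] by auto
    then show ?thesis by (metis dist_commute mem_ball)
  qed
  then obtain x u t where x: "\<And>k. dist (x k) p < 1 / real (Suc k)" and u: "\<And>k::nat. u k \<in> input_ball s"
    and t: "\<And>k. t k \<in> {0..T}" "\<And>k. norm p + 1 + real k < norm (flow f (t k) (x k) (u k))"
    by metis
  have "\<exists>\<sigma>. \<sigma> \<in> {0..t k} \<and> norm (flow f \<sigma> (x k) (u k)) = norm p + 1 \<and>
      (\<forall>r\<in>{0..\<sigma>}. norm (flow f r (x k) (u k)) \<le> norm p + 1)" for k
  proof -
    have "1 / real (Suc k) \<le> 1" by simp
    with x[of k] have "dist (x k) p < 1" by (rule less_le_trans)
    then have "norm (x k) \<le> norm p + 1"
      using norm_triangle_sub[of "x k" p] by (simp add: dist_norm)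
    then have "norm (flow f 0 (x k) (u k)) \<le> norm p + 1" by (simp add: flow_0[OF u])
    moreover have "norm p + 1 \<le> norm (flow f (t k) (x k) (u k))" using t(2)[of k] by linarith
    moreover have "0 \<le> t k" using t(1)[of k] by simp
    ultimately obtain \<sigma> where "\<sigma> \<in> {0..t k}" "norm (flow f \<sigma> (x k) (u k)) = norm p + 1"
        "\<And>r. r \<in> {0..\<sigma>} \<Longrightarrow> norm (flow f r (x k) (u k)) \<le> norm p + 1"
      using first_hitting_time[OF continuous_on_norm[OF flow_continuous[OF u]]] by metis
    then show ?thesis by blast
  qed
  then obtain \<sigma> where \<sigma>: "\<And>k. \<sigma> k \<in> {0..t k}" "\<And>k. norm (flow f (\<sigma> k) (x k) (u k)) = norm p + 1"
    "\<And>k r. r \<in> {0..\<sigma> k} \<Longrightarrow> norm (flow f r (x k) (u k)) \<le> norm p + 1"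
    by metis
  \<comment> \<open>Exit points and exit times converge along one subsequence; the limit time
    \<open>T1\<close> determines the horizon left at \<open>p'\<close>.\<close>
  define y where "y = (\<lambda>k. (flow f (\<sigma> k) (x k) (u k), \<sigma> k))"
  have "seq_compact (sphere 0 (norm p + 1) \<times> {0..T} :: ((real ^ 'n) \<times> real) set)"
    by (intro compact_imp_seq_compact compact_Times) auto
  moreover have "\<forall>k. y k \<in> sphere 0 (norm p + 1) \<times> {0..T}"
  proof
    fix k show "y k \<in> sphere 0 (norm p + 1) \<times> {0..T}"
      using \<sigma>(1,2)[of k] t(1)[of k] unfolding y_def by auto
  qed
  ultimately obtain l g where l: "l \<in> sphere 0 (norm p + 1) \<times> {0..T}" "strict_mono g" "(y \<circ> g) \<longlonglongrightarrow> l"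
    unfolding seq_compact_def by blast
  obtain p' T1 where l_eq: "l = (p', T1)" by (cases l)
  have lim: "(\<lambda>k. flow f (\<sigma> (g k)) (x (g k)) (u (g k))) \<longlonglongrightarrow> p'" "(\<lambda>k. \<sigma> (g k)) \<longlonglongrightarrow> T1"
    using tendsto_fst[OF l(3)] tendsto_snd[OF l(3)] by (simp_all add: l_eq y_def o_def)
  have near: "\<exists>k. real k \<ge> N \<and> dist (flow f (\<sigma> k) (x k) (u k)) p' < \<epsilon> \<and> dist (\<sigma> k) T1 < \<eta> \<and> 1 / real (Suc k) < \<epsilon>"
    if "\<epsilon> > 0" "\<eta> > 0" for N :: real and \<epsilon> \<eta> :: real
  proof -
    have "\<forall>\<^sub>F k in sequentially. N \<le> real k \<and> 1 / real (Suc k) < \<epsilon>"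
    proof (intro eventually_conj)
      show "\<forall>\<^sub>F k in sequentially. N \<le> real k"
        using filterlim_real_sequentially by (simp add: filterlim_at_top)
      show "\<forall>\<^sub>F k in sequentially. 1 / real (Suc k) < \<epsilon>"
        using order_tendstoD(2)[OF LIMSEQ_inverse_real_of_nat \<open>\<epsilon> > 0\<close>] by (simp add: inverse_eq_divide)
    qed
    then have "\<forall>\<^sub>F k in sequentially. N \<le> real (g k) \<and> 1 / real (Suc (g k)) < \<epsilon>"
      by (rule eventually_subseq[OF l(2)])
    with tendstoD[OF lim(1) that(1)] tendstoD[OF lim(2) that(2)]
    have "\<forall>\<^sub>F k in sequentially. real (g k) \<ge> N \<and> dist (flow f (\<sigma> (g k)) (x (g k)) (u (g k))) p' < \<epsilon> \<and>
        dist (\<sigma> (g k)) T1 < \<eta> \<and> 1 / real (Suc (g k)) < \<epsilon>"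
      by eventually_elim auto
    then show ?thesis using eventually_happens'[OF sequentially_bot] by blast
  qed
  show ?thesis
  proof (rule that[of p'])
    show "norm p' = norm p + 1" using l(1) by (simp add: l_eq)
    fix \<epsilon> :: real assume "\<epsilon> > 0"
    \<comment> \<open>The exit times are only close to \<open>T1\<close>, so the remaining horizon
      is taken as \<open>T - T1 + \<eta>\<close>. One \<open>\<eta>\<close> covers this error,
      another the gap between \<open>\<sigma> k\<close> and \<open>T1\<close>; together they amount
      to \<open>E - T\<close>.\<close>
    define \<eta> where "\<eta> = (E - T) / 2"
    have \<eta>: "\<eta> > 0" using \<open>T < E\<close> by (simp add: \<eta>_def)
    obtain k where k: "dist (flow f (\<sigma> k) (x k) (u k)) p' < \<epsilon>" "dist (\<sigma> k) T1 < \<eta>" "1 / real (Suc k) < \<epsilon>"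
      using near[OF \<open>\<epsilon> > 0\<close> \<eta>] by blast
    have "T - T1 + \<eta> < E - \<sigma> k" 
    proof -
      have "\<sigma> k < T1 + \<eta>" using k(2) by (simp add: dist_real_def)
      moreover have "2 * \<eta> = E - T" by (simp add: \<eta>_def)
      ultimately show ?thesis by linarith
    qed
    moreover have "\<exists>x\<in>ball p' \<epsilon>'. \<exists>u\<in>input_ball s. \<exists>t\<in>{0..T - T1 + \<eta>}. R < norm (flow f t x u)" if \<epsilon>': "\<epsilon>' > 0" for \<epsilon>' R
    proof -
      obtain m where m: "real m \<ge> R" "dist (flow f (\<sigma> m) (x m) (u m)) p' < \<epsilon>'" "dist (\<sigma> m) T1 < \<eta>"
        using near[OF \<epsilon>' \<eta>] by blast
      have "flow f (t m) (x m) (u m) = flow f (t m - \<sigma> m) (flow f (\<sigma> m) (x m) (u m)) (\<lambda>r. u m (\<sigma> m + r))"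
        using flow_shift[OF u, of "\<sigma> m" "t m - \<sigma> m" "x m" m] \<sigma>(1)[of m] by simp
      moreover have "R < norm (flow f (t m) (x m) (u m))" using t(2)[of m] m(1) norm_ge_zero[of p] by linarith
      moreover have "t m - \<sigma> m \<in> {0..T - T1 + \<eta>}" using \<sigma>(1)[of m] t(1)[of m] m(3) by (auto simp: dist_real_def)
      ultimately show ?thesis
        using m(2) shift_in_input_ball[OF u[of m], of "\<sigma> m"] by (metis dist_commute mem_ball)
    qed
    moreover have "\<sigma> k \<in> {0..T}" using \<sigma>(1)[of k] t(1)[of k] by auto
    moreover have "dist (x k) p < \<epsilon>" using x[of k] k(3) by simp
    ultimately show "\<exists>x u \<sigma>. \<exists>T' < E - \<sigma>. u \<in> input_ball s \<and> \<sigma> \<in> {0..T} \<and> dist x p < \<epsilon> \<and> dist (flow f \<sigma> x u) p' < \<epsilon> \<and>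
      (\<forall>t\<in>{0..\<sigma>}. norm (flow f t x u) \<le> norm p + 1) \<and>
      (\<forall>\<epsilon> R. \<epsilon> > 0 \<longrightarrow> (\<exists>x\<in>ball p' \<epsilon>. \<exists>u\<in>input_ball s. \<exists>t\<in>{0..T'}. R < norm (flow f t x u)))"
      using u[of k] k(1) \<sigma>(3)[of _ k]
      by (intro exI[of _ "x k"] exI[of _ "u k"] exI[of _ "\<sigma> k"] exI[of _ "T - T1 + \<eta>"] conjI) blast+
  qed
qed

text \<open>In each step of the chain the norm of the location grows by exactly 1, and the length of
  the piece is deducted from a time budget that stays positive. The shadowing trajectory would then
  reach arbitrarily large norms by time \<open>T + 1\<close>, although it is continuous up to
  then.\<close>

lemma reach_bounded:
  assumes "s \<ge> 0"
  obtains M where "\<And>x u t. norm x \<le> r \<Longrightarrow> u \<in> input_ball s \<Longrightarrow> t \<in> {0..T} \<Longrightarrow> norm (flow f t x u) \<le> M"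
proof (rule ccontr)
  assume "\<not> thesis"
  then have "\<exists>x u t. norm x \<le> r \<and> u \<in> input_ball s \<and> t \<in> {0..T} \<and> real k < norm (flow f t x u)" for k
    using that[of "real k"] by (meson not_le_imp_less)
  then obtain x u t where x: "\<And>k. norm (x k) \<le> r" and u: "\<And>k::nat. u k \<in> input_ball s"
    and t: "\<And>k. t k \<in> {0..T}" "\<And>k. real k < norm (flow f (t k) (x k) (u k))"
    by metis
  have "seq_compact (cball (0 :: real ^ 'n) r)" by (intro compact_imp_seq_compact) auto
  moreover have "\<forall>k. x k \<in> cball 0 r" using x by simp
  ultimately obtain p g where g: "strict_mono g" "(x \<circ> g) \<longlonglongrightarrow> p"
    unfolding seq_compact_def by blast
  define bad where "bad = (\<lambda>p T. \<forall>\<epsilon> R. \<epsilon> > 0 \<longrightarrow> (\<exists>x\<in>ball p \<epsilon>. \<exists>u\<in>input_ball s. \<exists>t\<in>{0..T}. R < norm (flow f t x u)))"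
  have "bad p T"
    unfolding bad_def
  proof (intro allI impI)
    fix \<epsilon> R :: real assume "\<epsilon> > 0"
    have "\<forall>\<^sub>F k in sequentially. R \<le> real k"
      using filterlim_real_sequentially by (simp add: filterlim_at_top)
    then have "\<forall>\<^sub>F k in sequentially. R \<le> real (g k)" by (rule eventually_subseq[OF g(1)])
    with tendstoD[OF g(2) \<open>\<epsilon> > 0\<close>] have "\<forall>\<^sub>F k in sequentially. R \<le> real (g k) \<and> dist (x (g k)) p < \<epsilon>"
      by eventually_elim auto
    then obtain k where "R \<le> real (g k)" "dist (x (g k)) p < \<epsilon>"
      using eventually_happens'[OF sequentially_bot] by blast
    then show "\<exists>x\<in>ball p \<epsilon>. \<exists>u\<in>input_ball s. \<exists>t\<in>{0..T}. R < norm (flow f t x u)"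
      using u t by (metis dist_commute mem_ball order_le_less_trans)
  qed
  \<comment> \<open>\<open>E\<close> is a strict upper bound for a bad horizon. The horizon itself
    picks up an error in each step, whereas \<open>E\<close> decreases exactly by the time spent, so
    that its sum with \<open>S j\<close> is constant.\<close>
  define B where "B = (\<lambda>(p, E). \<exists>T<E. bad p T)"
  define Q where "Q = (\<lambda>(p :: real ^ 'n, E) x (u :: real \<Rightarrow> real ^ 'm) \<sigma> (p' :: real ^ 'n, E').
    dist x p \<le> 1 \<and> norm p' = norm p + 1 \<and> E' = E - (\<sigma> :: real))"
  \<comment> \<open>Badness needs \<open>{0..T}\<close> to be nonempty, so
    \<open>0 \<le> T < E\<close>.\<close>
  have B_pos: "B (p, E) \<Longrightarrow> E > 0" for p E
    unfolding B_def bad_def by (fastforce dest: spec[of _ "1::real"])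
  obtain S q w x' u' b where near: "\<And>j t. t \<in> {0..S (Suc j) - S j} \<Longrightarrow> dist (flow f (S j + t) q w) (flow f t (x' j) (u' j)) \<le> 1"
    and Q: "\<And>j. Q (b j) (x' j) (u' j) (S (Suc j) - S j) (b (Suc j))"
    and w: "w \<in> input_ball s" and b0: "b 0 = (p, T + 1)" and S: "S 0 = 0" "mono S"
    and B: "\<And>j. B (b j)" and u': "\<And>j. u' j \<in> input_ball s"
  proof (rule shadowing_chain[where B = B and Q = Q and loc = fst and s = s and ?b0.0 = "(p, T + 1)"])
    show "B (p, T + 1)" using \<open>bad p T\<close> by (auto simp: B_def intro!: exI[of _ T])
    show "s \<ge> 0" by fact
    fix b assume "B b"
    obtain p E where b: "b = (p, E)" by (cases b)
    then obtain T where T: "T < E" "bad p T" using \<open>B b\<close> by (auto simp: B_def)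
    obtain p' where p': "norm p' = norm p + 1"
      "\<And>\<epsilon>. \<epsilon> > 0 \<Longrightarrow> \<exists>x u \<sigma>. \<exists>T' < E - \<sigma>. u \<in> input_ball s \<and> \<sigma> \<in> {0..T} \<and> dist x p < \<epsilon> \<and> dist (flow f \<sigma> x u) p' < \<epsilon> \<and>
        (\<forall>t\<in>{0..\<sigma>}. norm (flow f t x u) \<le> norm p + 1) \<and> bad p' T'"
      using exit_points_accumulate[of p s T E] T unfolding bad_def by metis
    have "\<exists>x u \<sigma> b'. B b' \<and> Q b x u \<sigma> b' \<and> u \<in> input_ball s \<and> 0 \<le> \<sigma> \<and> \<sigma> \<le> T \<and>
      dist x (fst b) < \<epsilon> \<and> dist (flow f \<sigma> x u) (fst b') < \<epsilon> \<and> (\<forall>t\<in>{0..\<sigma>}. norm (flow f t x u) \<le> norm p + 1)"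
      if \<epsilon>: "\<epsilon> > 0" for \<epsilon>
    proof -
      have min\<epsilon>: "0 < min \<epsilon> 1" using \<epsilon> by simp
      obtain x u \<sigma> T' where *: "T' < E - \<sigma>" "u \<in> input_ball s" "\<sigma> \<in> {0..T}" "dist x p < min \<epsilon> 1"
        "dist (flow f \<sigma> x u) p' < min \<epsilon> 1" "\<forall>t\<in>{0..\<sigma>}. norm (flow f t x u) \<le> norm p + 1" "bad p' T'"
        using p'(2)[OF min\<epsilon>] by blast
      from * have "B (p', E - \<sigma>)" "Q b x u \<sigma> (p', E - \<sigma>)" using p'(1) by (auto simp: B_def Q_def b)
      then show ?thesis using * b
        by (intro exI[of _ x] exI[of _ u] exI[of _ \<sigma>] exI[of _ "(p', E - \<sigma>)"]) auto
    qed
    then show "\<exists>R \<Sigma>. \<forall>\<epsilon>>0. \<exists>x u \<sigma> b'. B b' \<and> Q b x u \<sigma> b' \<and> u \<in> input_ball s \<and> 0 \<le> \<sigma> \<and> \<sigma> \<le> \<Sigma> \<and>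
      dist x (fst b) < \<epsilon> \<and> dist (flow f \<sigma> x u) (fst b') < \<epsilon> \<and> (\<forall>t\<in>{0..\<sigma>}. norm (flow f t x u) \<le> R)"
      by blast
  qed (rule that; assumption)
  have Qj: "dist (x' j) (fst (b j)) \<le> 1" "norm (fst (b (Suc j))) = norm (fst (b j)) + 1"
    "snd (b (Suc j)) = snd (b j) - (S (Suc j) - S j)" for j
    using Q[of j] by (auto simp: Q_def case_prod_beta')
  have "norm (fst (b j)) = norm p + real j \<and> snd (b j) + S j = T + 1" for j
    by (induction j) (use Qj b0 S in auto)
  moreover have "snd (b j) > 0" for j using B_pos[of "fst (b j)" "snd (b j)"] B by simp
  ultimately have b: "norm (fst (b j)) = norm p + real j \<and> S j \<le> T + 1" for j
    by (metis add_increasing less_imp_le order_refl)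
  obtain R where R: "\<And>t. t \<in> {0..T + 1} \<Longrightarrow> norm (flow f t q w) \<le> R"
    using flow_bounded[OF w, where T = "T + 1" and x = q] by blast
  \<comment> \<open>One unit is the shadowing error, the other the distance of the start
    \<open>x' j\<close> from the location.\<close>
  obtain j where j: "R + 2 < real j" using reals_Archimedean2 by blast
  have "S j \<ge> 0" using monoD[OF S(2), of 0 j] S(1) by simp
  then have "norm (flow f (S j) q w) \<le> R" using b[of j] by (intro R) auto
  moreover have "dist (flow f (S j) q w) (x' j) \<le> 1"
    using near[of 0 j] monoD[OF S(2), of j "Suc j"] by (simp add: flow_0[OF u'])
  ultimately have "norm (fst (b j)) \<le> R + 2"
    using Qj(1)[of j] norm_triangle_sub[of "fst (b j)" "x' j"] norm_triangle_sub[of "x' j" "flow f (S j) q w"]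
    by (simp add: dist_norm norm_minus_commute)
  then show False using b[of j] j norm_ge_zero[of p] by linarith
qed


text \<open>The level rises from \<open>c\<close> to \<open>c + 1\<close> because the shadowing
  trajectory is only within 1 of pieces that avoid the higher level. A point is kept in the chain if
  arbitrarily close states avoid that level for arbitrarily long times. Pieces have length 1, and
  \<open>reach_bounded\<close> bounds them and so supplies compactness for their endpoints.\<close>

lemma uniform_hitting_time:
  assumes "s \<ge> 0" and hit: "\<And>x u. u \<in> input_ball s \<Longrightarrow> \<exists>t\<ge>0. infdist (flow f t x u) A \<le> c"
  obtains \<tau> where "\<tau> \<ge> 0"
    "\<And>x u. norm x \<le> r \<Longrightarrow> u \<in> input_ball s \<Longrightarrow> \<exists>t\<in>{0..\<tau>}. infdist (flow f t x u) A \<le> c + 1"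
proof (rule ccontr)
  assume contra: "\<not> thesis"
  define avoids where "avoids = (\<lambda>x u \<tau>. \<forall>t\<in>{0..\<tau>}. c + 1 < infdist (flow f t x u) A)"
  have "\<exists>x u. norm x \<le> r \<and> u \<in> input_ball s \<and> avoids x u (real k)" for k
    using contra that[of "real k"] unfolding avoids_def by (meson not_le of_nat_0_le_iff)
  then obtain x u where x: "\<And>k. norm (x k) \<le> r" and u: "\<And>k::nat. u k \<in> input_ball s"
    and av: "\<And>k. avoids (x k) (u k) (real k)"
    by metis
  define B where "B = (\<lambda>p. \<forall>\<epsilon> \<tau>. \<epsilon> > 0 \<longrightarrow> (\<exists>x\<in>ball p \<epsilon>. \<exists>u\<in>input_ball s. avoids x u \<tau>))"
  \<comment> \<open>Stated for arbitrary sequences: it is applied to the initial counterexamples and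
    again to the time-one images of later ones.\<close>
  have accumulate: "\<exists>p. B p \<and> (\<forall>\<epsilon>>0. \<forall>N. \<exists>k\<ge>N. dist (x k) p < \<epsilon>)"
    if x: "\<And>k. norm (x k) \<le> r" and u: "\<And>k::nat. u k \<in> input_ball s" and av: "\<And>k. avoids (x k) (u k) (real k)"
    for x u r
  proof -
    have "seq_compact (cball (0 :: real ^ 'n) r)" by (intro compact_imp_seq_compact) auto
    moreover have "\<forall>k. x k \<in> cball 0 r" using x by simp
    ultimately obtain p g where g: "strict_mono g" "(x \<circ> g) \<longlonglongrightarrow> p"
      unfolding seq_compact_def by blast
    have near: "\<exists>k\<ge>N. dist (x k) p < \<epsilon>" if "\<epsilon> > 0" for \<epsilon> and N :: nat
    proof -
      have "\<forall>\<^sub>F k in sequentially. N \<le> g k" by (rule eventually_subseq[OF g(1) eventually_ge_at_top])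
      with tendstoD[OF g(2) \<open>\<epsilon> > 0\<close>] have "\<forall>\<^sub>F k in sequentially. N \<le> g k \<and> dist (x (g k)) p < \<epsilon>"
        by eventually_elim auto
      then show ?thesis using eventually_happens'[OF sequentially_bot] by blast
    qed
    have "B p"
      unfolding B_def
    proof (intro allI impI)
      fix \<epsilon> \<tau> :: real assume "\<epsilon> > 0"
      obtain N where "\<tau> \<le> real N" using real_arch_simple by blast
      obtain k where k: "k \<ge> N" "dist (x k) p < \<epsilon>" using near[OF \<open>\<epsilon> > 0\<close>] by blast
      then have "avoids (x k) (u k) \<tau>" using av[of k] \<open>\<tau> \<le> real N\<close> by (auto simp: avoids_def)
      then show "\<exists>x\<in>ball p \<epsilon>. \<exists>u\<in>input_ball s. avoids x u \<tau>"
        using k(2) u by (metis dist_commute mem_ball)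
    qed
    then show ?thesis using near by blast
  qed
  obtain p where p: "B p" using accumulate[OF x u av] by blast
  define Q where "Q = (\<lambda>(p :: real ^ 'n) x u \<sigma> (p' :: real ^ 'n). \<sigma> = (1 :: real) \<and> avoids x u 1)"
  obtain S q w x' u' b where near: "\<And>j t. t \<in> {0..S (Suc j) - S j} \<Longrightarrow> dist (flow f (S j + t) q w) (flow f t (x' j) (u' j)) \<le> 1"
    and Q: "\<And>j. Q (b j) (x' j) (u' j) (S (Suc j) - S j) (b (Suc j))"
    and w: "w \<in> input_ball s" and b0: "b 0 = p" and S: "S 0 = 0" "mono S"
    and B: "\<And>j. B (b j)" and u': "\<And>j. u' j \<in> input_ball s"
  proof (rule shadowing_chain[where B = B and Q = Q and loc = "\<lambda>p. p" and s = s and ?b0.0 = p])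
    show "B p" "s \<ge> 0" by fact+
    fix p assume p: "B p"
    obtain R where R: "\<And>x u t. norm x \<le> norm p + 1 \<Longrightarrow> u \<in> input_ball s \<Longrightarrow> t \<in> {0..1} \<Longrightarrow> norm (flow f t x u) \<le> R"
      using reach_bounded[OF \<open>s \<ge> 0\<close>, of "norm p + 1" 1] by blast
    \<comment> \<open>The extra unit of avoidance is consumed by the piece of length 1; its endpoint
      still avoids the level for time \<open>k\<close>.\<close>
    have "\<exists>x u. x \<in> ball p (1 / real (Suc k)) \<and> u \<in> input_ball s \<and> avoids x u (1 + real k)" for k
      using p unfolding B_def by (metis divide_pos_pos of_nat_0_less_iff zero_less_Suc zero_less_one)
    then obtain x u where x: "\<And>k. x k \<in> ball p (1 / real (Suc k))" and u: "\<And>k::nat. u k \<in> input_ball s"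
      and av: "\<And>k. avoids (x k) (u k) (1 + real k)"
      by metis
    have x_near: "norm (x k) \<le> norm p + 1" for k
    proof -
      have "1 / real (Suc k) \<le> 1" by simp
      with x[of k] have "dist (x k) p < 1" by (simp only: mem_ball dist_commute)
      then show ?thesis using norm_triangle_sub[of "x k" p] by (simp add: dist_norm)
    qed
    have "avoids (flow f 1 (x k) (u k)) (\<lambda>r. u k (1 + r)) (real k)" for k
      using av[of k] by (auto simp: avoids_def flow_shift[OF u, symmetric])
    then obtain p' where p': "B p'" "\<And>\<epsilon> N. \<epsilon> > 0 \<Longrightarrow> \<exists>k\<ge>N. dist (flow f 1 (x k) (u k)) p' < \<epsilon>"
      using accumulate[of "\<lambda>k. flow f 1 (x k) (u k)" R "\<lambda>k r. u k (1 + r)"]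
        R[OF x_near u, of 1] shift_in_input_ball[OF u] by auto
    have "\<exists>x u \<sigma> b'. B b' \<and> Q p x u \<sigma> b' \<and> u \<in> input_ball s \<and> 0 \<le> \<sigma> \<and> \<sigma> \<le> 1 \<and>
      dist x p < \<epsilon> \<and> dist (flow f \<sigma> x u) b' < \<epsilon> \<and> (\<forall>t\<in>{0..\<sigma>}. norm (flow f t x u) \<le> R)"
      if \<epsilon>: "\<epsilon> > 0" for \<epsilon>
    proof -
      obtain N where N: "1 / real (Suc N) < \<epsilon>" using \<epsilon> nat_approx_posE by metis
      obtain k where k: "k \<ge> N" "dist (flow f 1 (x k) (u k)) p' < \<epsilon>" using p'(2)[OF \<epsilon>] by blast
      have "1 / real (Suc k) \<le> 1 / real (Suc N)" using k by (simp add: frac_le)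
      then have "dist (x k) p < \<epsilon>" using x[of k] N by (simp add: dist_commute)
      moreover have "Q p (x k) (u k) 1 p'" using av[of k] by (auto simp: Q_def avoids_def)
      ultimately show ?thesis
        using p'(1) u[of k] k(2) R[OF x_near u]
        by (intro exI[of _ "x k"] exI[of _ "u k"] exI[of _ 1] exI[of _ p']) auto
    qed
    then show "\<exists>R \<Sigma>. \<forall>\<epsilon>>0. \<exists>x u \<sigma> b'. B b' \<and> Q p x u \<sigma> b' \<and> u \<in> input_ball s \<and> 0 \<le> \<sigma> \<and> \<sigma> \<le> \<Sigma> \<and>
      dist x p < \<epsilon> \<and> dist (flow f \<sigma> x u) b' < \<epsilon> \<and> (\<forall>t\<in>{0..\<sigma>}. norm (flow f t x u) \<le> R)"
      by blast
  qed (rule that; assumption)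
  have S_eq: "S j = real j" for j
  proof (induction j)
    case (Suc j)
    then show ?case using Q[of j] by (simp add: Q_def)
  qed (simp add: S)
  obtain t where t: "t \<ge> 0" "infdist (flow f t q w) A \<le> c" using hit[OF w] by blast
  define j where "j = nat \<lfloor>t\<rfloor>"
  have j: "t - real j \<in> {0..1}" using t(1) by (simp add: j_def) linarith
  then have "dist (flow f t q w) (flow f (t - real j) (x' j) (u' j)) \<le> 1"
    using near[of "t - real j" j] by (simp add: S_eq)
  moreover have "c + 1 < infdist (flow f (t - real j) (x' j) (u' j)) A"
    using Q[of j] j by (auto simp: Q_def avoids_def)
  ultimately show False
    using infdist_triangle[of "flow f (t - real j) (x' j) (u' j)" A "flow f t q w"] t(2)
    by (simp add: dist_commute)
qed

text \<open>From the sublevel set of height \<open>c + 1\<close> the state is within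
  \<open>R1\<close> after one unit of time, and from there the set is hit again within
  \<open>\<tau>1\<close>; excursions are thus bounded by \<open>R2\<close>. The compulsory first
  unit makes every return consume time at least 1, so the induction on \<open>n\<close> works.
  Absorption follows since \<open>G\<close> contains everything after the first visit.\<close>

lemma uniform_absorption:
  assumes "s \<ge> 0" and hit: "\<And>x u. u \<in> input_ball s \<Longrightarrow> \<exists>t\<ge>0. infdist (flow f t x u) A \<le> c"
    and A: "bounded A" "A \<noteq> {}"
    and G_def: "G = {flow f t x u | t x u. t \<ge> 0 \<and> infdist x A \<le> c + 1 \<and> u \<in> input_ball s}"
  shows "bounded G"
    and "\<exists>\<tau>\<ge>0. \<forall>x u t. norm x \<le> r \<longrightarrow> u \<in> input_ball s \<longrightarrow> t \<ge> \<tau> \<longrightarrow> flow f t x u \<in> G"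
proof -
  obtain M where M: "\<And>a. a \<in> A \<Longrightarrow> norm a \<le> M" using A(1) by (auto simp: bounded_iff)
  define R where "R = c + 1 + M"
  have D: "norm x \<le> R" if "infdist x A \<le> c + 1" for x
    using norm_le_infdist[OF A(2) M, of x] that by (simp add: R_def)
  obtain R1 where R1: "\<And>x u t. norm x \<le> R \<Longrightarrow> u \<in> input_ball s \<Longrightarrow> t \<in> {0..1} \<Longrightarrow> norm (flow f t x u) \<le> R1"
    using reach_bounded[OF \<open>s \<ge> 0\<close>, of R 1] by blast
  obtain \<tau>1 where \<tau>1: "\<tau>1 \<ge> 0"
    "\<And>x u. norm x \<le> R1 \<Longrightarrow> u \<in> input_ball s \<Longrightarrow> \<exists>t\<in>{0..\<tau>1}. infdist (flow f t x u) A \<le> c + 1"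
    using uniform_hitting_time[OF \<open>s \<ge> 0\<close> hit, of R1] by blast
  obtain R2 where R2: "\<And>x u t. norm x \<le> R \<Longrightarrow> u \<in> input_ball s \<Longrightarrow> t \<in> {0..1 + \<tau>1} \<Longrightarrow> norm (flow f t x u) \<le> R2"
    using reach_bounded[OF \<open>s \<ge> 0\<close>, of R "1 + \<tau>1"] by blast
  have "norm (flow f t x u) \<le> R2" if "infdist x A \<le> c + 1" "u \<in> input_ball s" "0 \<le> t" "t \<le> real n" for n t x u
    using that
  proof (induction n arbitrary: t x u)
    case 0
    then show ?case using R2[OF D, of x u t] \<tau>1(1) by simp
  next
    case (Suc n)
    show ?case
    proof (cases "t \<le> 1 + \<tau>1")
      case True
      then show ?thesis using R2[OF D, of x u t] Suc.prems by simp
    next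
      case False
      have "norm (flow f 1 x u) \<le> R1" using R1[OF D[OF Suc.prems(1)] Suc.prems(2), of 1] by simp
      from \<tau>1(2)[OF this shift_in_input_ball[OF Suc.prems(2), of 1]]
      obtain t1 where t1: "t1 \<in> {0..\<tau>1}" "infdist (flow f t1 (flow f 1 x u) (\<lambda>r. u (1 + r))) A \<le> c + 1"
        by blast
      have "infdist (flow f (1 + t1) x u) A \<le> c + 1"
        using t1 flow_shift[OF Suc.prems(2), of 1 t1 x] by simp
      then have "norm (flow f (t - (1 + t1)) (flow f (1 + t1) x u) (\<lambda>r. u ((1 + t1) + r))) \<le> R2"
        using False t1(1) Suc.prems by (intro Suc.IH shift_in_input_ball) auto
      then show ?thesis
        using flow_shift[OF Suc.prems(2), of "1 + t1" "t - (1 + t1)" x] t1(1) False by simp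
    qed
  qed
  then have "norm z \<le> R2" if "z \<in> G" for z
    using that real_arch_simple unfolding G_def by blast
  then show "bounded G" by (auto simp: bounded_iff)
  obtain \<tau> where \<tau>: "\<tau> \<ge> 0"
    "\<And>x u. norm x \<le> r \<Longrightarrow> u \<in> input_ball s \<Longrightarrow> \<exists>t\<in>{0..\<tau>}. infdist (flow f t x u) A \<le> c + 1"
    using uniform_hitting_time[OF \<open>s \<ge> 0\<close> hit, of r] by blast
  have "flow f t x u \<in> G" if x: "norm x \<le> r" and u: "u \<in> input_ball s" and t: "t \<ge> \<tau>" for x u t
  proof -
    obtain t1 where t1: "t1 \<in> {0..\<tau>}" "infdist (flow f t1 x u) A \<le> c + 1" using \<tau>(2)[OF x u] by blast
    have "flow f t x u = flow f (t - t1) (flow f t1 x u) (\<lambda>r. u (t1 + r))"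
      using flow_shift[OF u, of t1 "t - t1" x] t1(1) t by simp
    moreover have "t - t1 \<ge> 0" using t1 t by simp
    ultimately show ?thesis unfolding G_def using t1(2) shift_in_input_ball[OF u] by blast
  qed
  then show "\<exists>\<tau>\<ge>0. \<forall>x u t. norm x \<le> r \<longrightarrow> u \<in> input_ball s \<longrightarrow> t \<ge> \<tau> \<longrightarrow> flow f t x u \<in> G"
    using \<tau>(1) by blast
qed

text \<open>An earlier input followed by \<open>u\<close> is again admissible, so \<open>G\<close>
  itself is invariant; continuity in the initial state carries this to the closure.\<close>

lemma reachable_set_invariant:
  assumes u: "u \<in> input_ball s" and t: "t \<ge> 0"
    and G_def: "G = {flow f t x u | t x u. t \<ge> 0 \<and> x \<in> D \<and> u \<in> input_ball s}"
    and x: "x \<in> closure G"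
  shows "flow f t x u \<in> closure G"
proof -
  have "flow f t z u \<in> G" if z: "z \<in> G" for z
  proof -
    obtain r y v where y: "z = flow f r y v" "r \<ge> 0" "y \<in> D" "v \<in> input_ball s"
      using z unfolding G_def by blast
    then have "flow f t z u = flow f (r + t) y (concat_input r v u)"
      using flow_concat_after[OF y(4) u t y(2)] by simp
    then show ?thesis
      unfolding G_def using y concat_in_input_ball[OF y(4) u, of r] t
      by (intro CollectI exI[of _ "r + t"] exI[of _ y] exI[of _ "concat_input r v u"]) auto
  qed
  then have "(\<lambda>z. flow f t z u) ` closure G \<subseteq> closure G"
    using continuous_on_subset[OF flow_continuous_initial[OF u t], of "closure G"] closure_subset[of G]
    by (intro image_closure_subset) auto
  then show ?thesis using x by blast
qed

end

section \<open>Equivalence of the stability notions\<close>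

text \<open>If a nearly closest \<open>a\<close> is farther than \<open>c\<close> from
  \<open>z\<close>, the witness lies on the segment between them at distance \<open>c\<close> from
  \<open>a\<close>. The strict inequality accounts for an infimum that need not be attained, as
  \<open>A\<close> may fail to be closed.\<close>

lemma infdist_sublevel_le:
  fixes z :: "'a::real_normed_vector"
  assumes "A \<noteq> {}" "c \<ge> 0" "d \<ge> 0" and less: "infdist z A < d + c"
  shows "infdist z {x. infdist x A \<le> c} \<le> d"
proof -
  obtain a where a: "a \<in> A" "dist z a < d + c"
    using less assms(1) by (auto simp: infdist_notempty cINF_less_iff)
  show ?thesis
  proof (cases "dist z a \<le> c")
    case True
    then have "infdist z A \<le> c" using infdist_le2[OF a(1)] by blast
    then show ?thesis using \<open>d \<ge> 0\<close> by simp
  next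
    case False
    define l where "l = c / dist z a"
    define y where "y = a + l *\<^sub>R (z - a)"
    have l: "0 \<le> l" "l \<le> 1" "l * dist z a = c"
      using False \<open>c \<ge> 0\<close> by (auto simp: l_def divide_le_eq_1)
    have "dist y a = c" using l by (simp add: y_def dist_norm)
    then have y: "infdist y A \<le> c" using infdist_le2[OF a(1)] by simp
    have "z - y = (1 - l) *\<^sub>R (z - a)" by (simp add: y_def algebra_simps)
    then have "dist z y = (1 - l) * dist z a" using l by (simp add: dist_norm)
    also have "\<dots> = dist z a - c" using l(3) by (simp add: algebra_simps)
    finally have "dist z y \<le> d" using a(2) by simp
    then show ?thesis using y by (intro infdist_le2[of y]) auto
  qed
qed

section \<open>Easy implications between the stability notions\<close>

lemma class_K_mono: "class_K \<gamma> \<Longrightarrow> 0 \<le> x \<Longrightarrow> x \<le> y \<Longrightarrow> \<gamma> x \<le> \<gamma> y"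
  unfolding class_K_def by (cases "x = y") (auto dest: strict_mono_onD[of _ _ x y])

lemma class_K_nonneg: "class_K \<gamma> \<Longrightarrow> 0 \<le> x \<Longrightarrow> 0 \<le> \<gamma> x"
  using class_K_mono[of \<gamma> 0 x] by (simp add: class_K_def)

lemma class_KL_eventually_less:
  assumes "class_KL \<beta>" "0 \<le> r" "0 < \<epsilon>"
  obtains \<tau> where "0 \<le> \<tau>" "\<And>t. \<tau> \<le> t \<Longrightarrow> \<beta> r t < \<epsilon>"
proof (cases "r = 0")
  case True
  have "\<beta> 0 t = 0" if "0 \<le> t" for t using assms(1) that by (auto simp: class_KL_def class_K_def)
  then show ?thesis using that[of 0] True assms(3) by simp
next
  case False
  then have "((\<beta> r) \<longlongrightarrow> 0) at_top" using assms by (auto simp: class_KL_def class_L_def)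
  then have "\<forall>\<^sub>F t in at_top. \<beta> r t < \<epsilon>" using assms(3) by (rule order_tendstoD)
  then obtain N where "\<And>t. N \<le> t \<Longrightarrow> \<beta> r t < \<epsilon>" by (auto simp: eventually_at_top_linorder)
  then show ?thesis using that[of "max 0 N"] by simp
qed

lemma ISS_wrt_imp_ISpS_wrt:
  assumes "ISS_wrt f A" shows "ISpS_wrt f A"
proof -
  obtain \<beta> \<gamma> where "class_KL \<beta>" "class_K_inf \<gamma>"
    and *: "\<And>x u t. u \<in> inputs \<Longrightarrow> 0 \<le> t \<Longrightarrow> infdist (flow f t x u) A \<le> \<beta> (infdist x A) t + \<gamma> (input_norm u)"
    using assms unfolding ISS_wrt_def by blast
  moreover have "infdist (flow f t x u) A \<le> \<beta> (infdist x A) t + \<gamma> (input_norm u) + 1" if "u \<in> inputs" "0 \<le> t" for x u t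
    using *[OF that, of x] by simp
  ultimately show ?thesis unfolding ISpS_wrt_def by (metis zero_less_one)
qed

lemma ISS_wrt_imp_UAG_wrt:
  assumes "ISS_wrt f A" shows "UAG_wrt f A"
proof -
  obtain \<beta> \<gamma> where \<beta>: "class_KL \<beta>" and \<gamma>: "class_K_inf \<gamma>"
    and *: "\<And>x u t. u \<in> inputs \<Longrightarrow> 0 \<le> t \<Longrightarrow> infdist (flow f t x u) A \<le> \<beta> (infdist x A) t + \<gamma> (input_norm u)"
    using assms unfolding ISS_wrt_def by blast
  have "\<exists>\<tau>. \<forall>u\<in>inputs. \<forall>x\<in>closure (set_ball r A). \<forall>t\<ge>0. t \<ge> \<tau> \<longrightarrow>
      infdist (flow f t x u) A \<le> \<epsilon> + \<gamma> (input_norm u)" if "\<epsilon> > 0" "r > 0" for \<epsilon> r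
  proof -
    obtain \<tau> where \<tau>: "\<And>t. \<tau> \<le> t \<Longrightarrow> \<beta> r t < \<epsilon>"
      using class_KL_eventually_less[OF \<beta>, of r \<epsilon>] \<open>\<epsilon> > 0\<close> \<open>r > 0\<close> by auto
    have "closed {x. infdist x A \<le> r}" by (intro closed_Collect_le continuous_intros)
    then have cl: "closure (set_ball r A) \<subseteq> {x. infdist x A \<le> r}"
      by (intro closure_minimal) (auto simp: set_ball_def)
    have "infdist (flow f t x u) A \<le> \<epsilon> + \<gamma> (input_norm u)"
      if "u \<in> inputs" "x \<in> closure (set_ball r A)" "t \<ge> 0" "t \<ge> \<tau>" for u x t
    proof -
      have "class_K (\<lambda>r. \<beta> r t)" using \<beta> that by (simp add: class_KL_def)
      then have "\<beta> (infdist x A) t \<le> \<beta> r t"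
        using class_K_mono[of "\<lambda>r. \<beta> r t" "infdist x A" r] cl that by (auto simp: infdist_nonneg)
      then show ?thesis using *[OF that(1,3), of x] \<tau>[OF that(4)] by simp
    qed
    then show ?thesis by blast
  qed
  then show ?thesis unfolding UAG_wrt_def using \<gamma> by blast
qed

lemma UAG_wrt_imp_LIM_wrt:
  assumes "UAG_wrt f A" shows "LIM_wrt f A"
proof -
  obtain \<gamma> where \<gamma>: "class_K_inf \<gamma>"
    and *: "\<And>\<epsilon> r. \<epsilon> > 0 \<Longrightarrow> r > 0 \<Longrightarrow> \<exists>\<tau>. \<forall>u\<in>inputs. \<forall>x\<in>closure (set_ball r A). \<forall>t\<ge>0. t \<ge> \<tau> \<longrightarrow>
        infdist (flow f t x u) A \<le> \<epsilon> + \<gamma> (input_norm u)"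
    using assms unfolding UAG_wrt_def by blast
  have "\<exists>t\<ge>0. infdist (flow f t x u) A \<le> \<epsilon> + \<gamma> (input_norm u)" if "u \<in> inputs" "\<epsilon> > 0" for x u \<epsilon>
  proof -
    have "infdist x A + 1 > 0" using infdist_nonneg[of x A] by simp
    then obtain \<tau> where "\<forall>u\<in>inputs. \<forall>x\<in>closure (set_ball (infdist x A + 1) A). \<forall>t\<ge>0. t \<ge> \<tau> \<longrightarrow>
        infdist (flow f t x u) A \<le> \<epsilon> + \<gamma> (input_norm u)"
      using * \<open>\<epsilon> > 0\<close> by blast
    moreover have "x \<in> closure (set_ball (infdist x A + 1) A)"
      by (rule subsetD[OF closure_subset]) (simp add: set_ball_def)
    ultimately show ?thesis using that(1) by (intro exI[of _ "max 0 \<tau>"]) auto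
  qed
  then show ?thesis unfolding LIM_wrt_def using \<gamma> by blast
qed

text \<open>The offset \<open>c\<close> is absorbed by passing to the sublevel set of height
  \<open>c\<close>. The KL term falls strictly below \<open>\<epsilon>\<close>, which provides the
  strict inequality for \<open>infdist_sublevel_le\<close>.\<close>

lemma ISpS_imp_LIM_wrt:
  assumes "ISpS f"
  obtains A where "bounded A" "A \<noteq> {}" "LIM_wrt f A"
proof -
  obtain A \<beta> \<gamma> c where A: "bounded A" "A \<noteq> {}" and \<beta>: "class_KL \<beta>" and \<gamma>: "class_K_inf \<gamma>" and c: "c > 0"
    and *: "\<And>x u t. u \<in> inputs \<Longrightarrow> 0 \<le> t \<Longrightarrow> infdist (flow f t x u) A \<le> \<beta> (infdist x A) t + \<gamma> (input_norm u) + c"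
    using assms unfolding ISpS_def ISpS_wrt_def by blast
  let ?A = "{x. infdist x A \<le> c}"
  obtain M where "\<And>a. a \<in> A \<Longrightarrow> norm a \<le> M" using A(1) by (auto simp: bounded_iff)
  then have "norm x \<le> c + M" if "x \<in> ?A" for x
    using norm_le_infdist[OF A(2), of M x] that by fastforce
  then have "bounded ?A" by (auto simp: bounded_iff)
  moreover have "?A \<noteq> {}" using A(2) c infdist_zero less_imp_le by (metis (mono_tags) all_not_in_conv mem_Collect_eq)
  moreover have "\<exists>t\<ge>0. infdist (flow f t x u) ?A \<le> \<epsilon> + \<gamma> (input_norm u)" if "u \<in> inputs" "\<epsilon> > 0" for x u \<epsilon>
  proof -
    obtain t where t: "0 \<le> t" "\<beta> (infdist x A) t < \<epsilon>"
      using class_KL_eventually_less[OF \<beta> infdist_nonneg \<open>\<epsilon> > 0\<close>, of x A] by blast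
    have "infdist (flow f t x u) A < (\<epsilon> + \<gamma> (input_norm u)) + c" using *[OF that(1) t(1), of x] t(2) by simp
    moreover have "0 \<le> \<epsilon> + \<gamma> (input_norm u)"
      using \<gamma> \<open>\<epsilon> > 0\<close> class_K_nonneg[OF _ input_norm_nonneg, of \<gamma> u] by (simp add: class_K_inf_def)
    ultimately show ?thesis using t(1) infdist_sublevel_le[OF A(2)] c by (metis less_imp_le)
  qed
  then have "LIM_wrt f ?A" unfolding LIM_wrt_def using \<gamma> by blast
  ultimately show ?thesis using that by blast
qed

context control_system begin

text \<open>For inputs of norm at most \<open>s\<close>, invariance and absorption let
  \<open>\<kappa>\<close> alone suffice. For larger inputs, of level \<open>k\<close>, the transient
  bound depends on \<open>k\<close> and on the initial distance \<open>r\<close>: it is charged to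
  the gain if \<open>r \<le> k\<close> and to \<open>\<kappa>\<close> if \<open>r > k\<close>, so
  that in each case a function of one variable dominates.\<close>

lemma LIM_wrt_imp_ISS_wrt:
  assumes A: "bounded A" "A \<noteq> {}" "LIM_wrt f A" and "s > 0"
  obtains K where "compact K" "K \<noteq> {}" "s_invariant f s K" "ISS_wrt f K"
proof -
  obtain \<gamma> where \<gamma>: "class_K \<gamma>"
    and lim: "\<And>x u \<epsilon>. u \<in> inputs \<Longrightarrow> \<epsilon> > 0 \<Longrightarrow> \<exists>t\<ge>0. infdist (flow f t x u) A \<le> \<epsilon> + \<gamma> (input_norm u)"
    using A(3) unfolding LIM_wrt_def class_K_inf_def by blast
  \<comment> \<open>Countably many levels of input bounds suffice; level 0 is the given bound \<open>s\<close>.\<close>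
  define \<sigma> where "\<sigma> = (\<lambda>k::nat. if k = 0 then s else real k)"
  have \<sigma>_nonneg: "\<sigma> k \<ge> 0" for k using \<open>s > 0\<close> by (simp add: \<sigma>_def)
  have hit: "\<exists>t\<ge>0. infdist (flow f t x u) A \<le> 1 + \<gamma> (\<sigma> k)" if u: "u \<in> input_ball (\<sigma> k)" for k x u
  proof -
    have "\<gamma> (input_norm u) \<le> \<gamma> (\<sigma> k)"
      by (rule class_K_mono[OF \<gamma> input_norm_nonneg input_norm_input_ball[OF u]])
    moreover have "u \<in> inputs" using u input_ball_subset_inputs by blast
    ultimately show ?thesis using lim[of u 1 x] by fastforce
  qed
  define G where "G = (\<lambda>k. {flow f t x u | t x u. t \<ge> 0 \<and> infdist x A \<le> 1 + \<gamma> (\<sigma> k) + 1 \<and> u \<in> input_ball (\<sigma> k)})"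
  have G_bounded: "bounded (G k)" for k
    by (rule uniform_absorption(1)[OF \<sigma>_nonneg hit A(1,2) G_def[THEN fun_cong]])
  have G_absorbs: "\<exists>\<tau>\<ge>0. \<forall>x u t. norm x \<le> r \<longrightarrow> u \<in> input_ball (\<sigma> k) \<longrightarrow> t \<ge> \<tau> \<longrightarrow> flow f t x u \<in> G k" for k r
    by (rule uniform_absorption(2)[OF \<sigma>_nonneg hit A(1,2) G_def[THEN fun_cong]])
  define K where "K = closure (G 0)"
  have K: "compact K" using G_bounded by (simp add: K_def compact_closure)
  have K_inv: "flow f t x u \<in> K" if "u \<in> input_ball s" "t \<ge> 0" "x \<in> K" for t x u
    using that reachable_set_invariant[of u s t "G 0" "{x. infdist x A \<le> 1 + \<gamma> s + 1}" x]
    unfolding K_def G_def \<sigma>_def by simp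
  obtain a0 where "a0 \<in> A" using A(2) by blast
  have zero: "(\<lambda>t. 0) \<in> input_ball s" using \<open>s > 0\<close> by (simp add: input_ball_def)
  have "\<gamma> s \<ge> 0" using class_K_nonneg[OF \<gamma>] \<open>s > 0\<close> by simp
  then have "flow f 0 a0 (\<lambda>t. 0) \<in> G 0"
    unfolding G_def using zero \<open>a0 \<in> A\<close>
    by (intro CollectI exI[of _ 0] exI[of _ a0] exI[of _ "\<lambda>t. 0"]) (auto simp: \<sigma>_def)
  then have "a0 \<in> K" unfolding K_def by (simp add: flow_0[OF zero] subsetD[OF closure_subset])
  then have K_ne: "K \<noteq> {}" by blast
  obtain M where M: "\<And>a. a \<in> K \<Longrightarrow> norm a \<le> M" using compact_imp_bounded[OF K] by (auto simp: bounded_iff)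
  have infdist_K_le: "infdist y K \<le> norm y + M" for y
    using infdist_le[OF \<open>a0 \<in> K\<close>, of y] norm_triangle_ineq4[of y a0] M[OF \<open>a0 \<in> K\<close>] by (simp add: dist_norm)

  \<comment> \<open>Distances are discretised by \<open>n\<close> and inputs by \<open>k\<close>, so
    that the constants form double sequences: \<open>h\<close> bounds whole trajectories,
    \<open>\<tau>\<close> is a time after which they lie in \<open>G k\<close>.\<close>
  define bounds where "bounds = (\<lambda>k n \<tau> h. 0 \<le> h \<and> 0 \<le> \<tau> \<and>
    (\<forall>x u t. infdist x K \<le> real n \<longrightarrow> u \<in> input_ball (\<sigma> k) \<longrightarrow> 0 \<le> t \<longrightarrow>
      infdist (flow f t x u) K \<le> h \<and> (\<tau> \<le> t \<longrightarrow> flow f t x u \<in> G k)))"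
  have "\<exists>\<tau> h. bounds k n \<tau> h" for k n
  proof -
    define r where "r = real n + M"
    obtain \<tau> where \<tau>: "\<tau> \<ge> 0" "\<And>x u t. norm x \<le> r \<Longrightarrow> u \<in> input_ball (\<sigma> k) \<Longrightarrow> t \<ge> \<tau> \<Longrightarrow> flow f t x u \<in> G k"
      using G_absorbs by blast
    obtain M1 where M1: "\<And>x u t. norm x \<le> r \<Longrightarrow> u \<in> input_ball (\<sigma> k) \<Longrightarrow> t \<in> {0..\<tau>} \<Longrightarrow> norm (flow f t x u) \<le> M1"
      using reach_bounded[OF \<sigma>_nonneg, of r k \<tau>] by blast
    obtain M2 where M2: "\<And>y. y \<in> G k \<Longrightarrow> norm y \<le> M2" using G_bounded[of k] by (auto simp: bounded_iff)
    define h where "h = max 0 (max M1 M2 + M)"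
    have "infdist (flow f t x u) K \<le> h \<and> (\<tau> \<le> t \<longrightarrow> flow f t x u \<in> G k)"
      if "infdist x K \<le> real n" "u \<in> input_ball (\<sigma> k)" "0 \<le> t" for x u t
    proof -
      have x: "norm x \<le> r" using norm_le_infdist[OF K_ne M, of x] that(1) by (simp add: r_def)
      have "norm (flow f t x u) \<le> max M1 M2"
        using M1[OF x that(2), of t] M2[OF \<tau>(2)[OF x that(2), of t]] that(3) by (cases "\<tau> \<le> t") auto
      then show ?thesis using infdist_K_le[of "flow f t x u"] \<tau>(2)[OF x that(2)] by (simp add: h_def)
    qed
    then show ?thesis
      unfolding bounds_def using \<tau>(1) by (intro exI[of _ \<tau>] exI[of _ h]) (auto simp: h_def)
  qed
  then obtain \<tau> h where bounds: "\<And>k n. bounds k n (\<tau> k n) (h k n)" by metis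
  then have h_nonneg: "\<And>k n. 0 \<le> h k n"
    and h: "\<And>k n x u t. infdist x K \<le> real n \<Longrightarrow> u \<in> input_ball (\<sigma> k) \<Longrightarrow> 0 \<le> t \<Longrightarrow> infdist (flow f t x u) K \<le> h k n"
    unfolding bounds_def by blast+
  have G: "flow f t x u \<in> G k" if "infdist x K \<le> real n" "u \<in> input_ball (\<sigma> k)" "\<tau> k n \<le> t" for k n x u t
  proof -
    have "0 \<le> \<tau> k n" using bounds unfolding bounds_def by blast
    then have "0 \<le> t" using that(3) by simp
    then show ?thesis using bounds that unfolding bounds_def by blast
  qed
  have "\<exists>g. 0 \<le> g \<and> (\<forall>y\<in>G k. infdist y K \<le> g)" for k
  proof -
    obtain M2 where M2: "\<And>y. y \<in> G k \<Longrightarrow> norm y \<le> M2" using G_bounded[of k] by (auto simp: bounded_iff)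
    have "infdist y K \<le> max 0 (M2 + M)" if "y \<in> G k" for y
      using infdist_K_le[of y] M2[OF that] by simp
    then show ?thesis by (intro exI[of _ "max 0 (M2 + M)"]) auto
  qed
  then obtain g where g: "\<And>k. 0 \<le> g k" "\<And>k y. y \<in> G k \<Longrightarrow> infdist y K \<le> g k" by metis
  have G0: "infdist y K = 0" if "y \<in> G 0" for y
    using that closure_subset[of "G 0"] by (auto simp: K_def)

  \<comment> \<open>The bound \<open>h\<close> does not vanish at distance 0. Here the trajectory is
    compared with that of a nearest point of \<open>K\<close>, which remains in
    \<open>K\<close>.\<close>
  obtain C where C: "C \<ge> 0"
    "\<And>x u t. infdist x K \<le> 1 \<Longrightarrow> u \<in> input_ball s \<Longrightarrow> t \<in> {0..\<tau> 0 1} \<Longrightarrow> infdist (flow f t x u) K \<le> C * infdist x K"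
  proof -
    obtain M1 where M1: "\<And>x u t. norm x \<le> 1 + M \<Longrightarrow> u \<in> input_ball s \<Longrightarrow> t \<in> {0..\<tau> 0 1} \<Longrightarrow> norm (flow f t x u) \<le> M1"
      using reach_bounded[of s "1 + M" "\<tau> 0 1"] \<open>s > 0\<close> by auto
    obtain L where L: "L \<ge> 0" "\<And>v x y. norm v \<le> s \<Longrightarrow> norm x \<le> M1 \<Longrightarrow> norm y \<le> M1 \<Longrightarrow>
        norm (f x v - f y v) \<le> L * norm (x - y)"
      using lipschitz_state[of s M1] by blast
    have "infdist (flow f t x u) K \<le> exp (L * \<tau> 0 1) * infdist x K"
      if x: "infdist x K \<le> 1" and u: "u \<in> input_ball s" and t: "t \<in> {0..\<tau> 0 1}" for x u t
    proof -
      obtain a where a: "a \<in> K" "infdist x K = dist x a"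
        using infdist_attains_inf[OF compact_imp_closed[OF K] K_ne, of x] by blast
      have x_norm: "norm x \<le> 1 + M" using norm_le_infdist[OF K_ne M, of x] x by simp
      have a_norm: "norm a \<le> 1 + M" using M[OF a(1)] by simp
      have "infdist (flow f t x u) K \<le> dist (flow f t x u) (flow f t a u)"
        using K_inv[OF u _ a(1)] t by (intro infdist_le) auto
      also have "\<dots> \<le> exp (L * t) * norm (x - a)"
        unfolding dist_norm
        by (rule flow_two_bounded(1)[OF u _ _ _ L]) (use t M1 u x_norm a_norm in auto)
      also have "\<dots> \<le> exp (L * \<tau> 0 1) * norm (x - a)"
        using t L(1) by (intro mult_right_mono) (auto intro!: mult_left_mono)
      finally show ?thesis using a(2) by (simp add: dist_norm)
    qed
    then show ?thesis using that[of "exp (L * \<tau> 0 1)"] by simp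
  qed

  \<comment> \<open>The indices \<open>k \<le> n\<close> are the part of the double sequence charged
    to \<open>\<kappa>\<close>; the factor \<open>exp (\<tau> k n)\<close> makes up for the decay of
    \<open>exp (- t)\<close> during the transient.\<close>
  define a where "a = (\<lambda>n. \<Sum>k\<le>n. h k n * exp (\<tau> k n))"
  obtain \<kappa> where \<kappa>: "class_K_inf \<kappa>" "\<And>r. r \<ge> 0 \<Longrightarrow> C * exp (\<tau> 0 1) * r \<le> \<kappa> r" "\<And>r. r \<ge> 1 \<Longrightarrow> a (nat \<lceil>r\<rceil>) \<le> \<kappa> r"
    using class_K_inf_majorant[of 1 "C * exp (\<tau> 0 1)" a] by auto
  \<comment> \<open>Only inputs of norm above \<open>s\<close> use this gain: \<open>g\<close>
    covers the time after absorption, the diagonal terms of \<open>h\<close> the trajectories from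
    distances up to \<open>k\<close>.\<close>
  obtain \<gamma>' where \<gamma>': "class_K_inf \<gamma>'" "\<And>r. r \<ge> s \<Longrightarrow> g (nat \<lceil>r\<rceil>) + h (nat \<lceil>r\<rceil>) (nat \<lceil>r\<rceil>) \<le> \<gamma>' r"
    by (rule class_K_inf_majorant[OF \<open>s > 0\<close>, of 0 "\<lambda>n. g n + h n n"]) (rule that; assumption)
  have \<kappa>_nonneg: "0 \<le> \<kappa> r * exp (- t)" if "r \<ge> 0" for r t
    using class_K_nonneg[of \<kappa> r] \<kappa>(1) that by (simp add: class_K_inf_def)
  have \<gamma>'_nonneg: "0 \<le> \<gamma>' (input_norm u)" for u :: "real \<Rightarrow> real ^ 'm"
    by (rule class_K_nonneg[OF _ input_norm_nonneg]) (use \<gamma>'(1) in \<open>simp add: class_K_inf_def\<close>)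
  have transient: "h k (nat \<lceil>r\<rceil>) \<le> \<kappa> r * exp (- t)" if "r \<ge> 1" "k \<le> nat \<lceil>r\<rceil>" "t \<le> \<tau> k (nat \<lceil>r\<rceil>)" for k r t
  proof -
    let ?n = "nat \<lceil>r\<rceil>"
    have "h k ?n * exp t \<le> h k ?n * exp (\<tau> k ?n)" using that h_nonneg by (intro mult_left_mono) auto
    also have "\<dots> \<le> a ?n"
      unfolding a_def using that h_nonneg by (intro member_le_sum) auto
    also have "\<dots> \<le> \<kappa> r" using \<kappa>(3)[OF that(1)] .
    finally show ?thesis by (simp add: exp_minus field_simps)
  qed
  have estimate: "infdist (flow f t x u) K \<le> \<kappa> (infdist x K) * exp (- t) + \<gamma>' (input_norm u)"
    if u: "u \<in> inputs" and t: "t \<ge> 0" for x u t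
  proof -
    define r where "r = infdist x K"
    have r: "r \<ge> 0" by (simp add: r_def infdist_nonneg)
    have rn: "infdist x K \<le> real (nat \<lceil>r\<rceil>)" using r by (simp add: r_def)
    show ?thesis
    proof (cases "input_norm u \<le> s")
      case True
      obtain v where v: "v \<in> input_ball s" "\<And>t x. flow f t x u = flow f t x v"
        using flow_input_ball[OF u True] by blast
      then have v0: "v \<in> input_ball (\<sigma> 0)" by (simp add: \<sigma>_def)
      have "infdist (flow f t x v) K \<le> \<kappa> r * exp (- t)"
      proof (cases "r \<le> 1")
        case True
        show ?thesis
        proof (cases "\<tau> 0 1 \<le> t")
          case True
          then have "flow f t x v \<in> G 0" using G[OF _ v0, of x 1 t] \<open>r \<le> 1\<close> by (simp add: r_def)
          then show ?thesis using G0 \<kappa>_nonneg[OF r] by simp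
        next
          case False
          have "infdist (flow f t x v) K \<le> C * r"
            unfolding r_def by (rule C(2)) (use True False t v in \<open>auto simp: r_def\<close>)
          also have "\<dots> * exp t \<le> C * r * exp (\<tau> 0 1)"
            using False C(1) r by (intro mult_left_mono) auto
          also have "\<dots> \<le> \<kappa> r" using \<kappa>(2)[OF r] by (simp add: mult_ac)
          finally show ?thesis by (simp add: exp_minus field_simps)
        qed
      next
        case False
        show ?thesis
        proof (cases "\<tau> 0 (nat \<lceil>r\<rceil>) \<le> t")
          case True
          then show ?thesis using G0[OF G[OF rn v0]] \<kappa>_nonneg[OF r] by simp
        next
          case False
          then show ?thesis using h[OF rn v0 t] transient[of r 0 t] \<open>\<not> r \<le> 1\<close> by simp
        qed
      qed
      then show ?thesis using v(2) \<gamma>'_nonneg[of u] by (simp add: r_def)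
    next
      case False
      define k where "k = nat \<lceil>input_norm u\<rceil>"
      have k: "input_norm u \<le> real k" "k \<ge> 1" using False \<open>s > 0\<close> by (auto simp: k_def) linarith
      obtain v where v: "v \<in> input_ball (real k)" "\<And>t x. flow f t x u = flow f t x v"
        using flow_input_ball[OF u k(1)] by blast
      then have vk: "v \<in> input_ball (\<sigma> k)" using k(2) by (simp add: \<sigma>_def)
      have \<gamma>'k: "g k + h k k \<le> \<gamma>' (input_norm u)" using \<gamma>'(2)[of "input_norm u"] False by (simp add: k_def)
      have "infdist (flow f t x v) K \<le> \<kappa> r * exp (- t) + (g k + h k k)"
      proof (cases "r \<le> real k")
        case True
        then show ?thesis using h[OF _ vk t, of x k] g(1)[of k] \<kappa>_nonneg[OF r, of t] by (simp add: r_def)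
      next
        case False
        then have *: "k \<le> nat \<lceil>r\<rceil>" "r \<ge> 1" using k(2) by linarith+
        show ?thesis
        proof (cases "\<tau> k (nat \<lceil>r\<rceil>) \<le> t")
          case True
          then show ?thesis
            using g(2)[OF G[OF rn vk True]] h_nonneg[of k k] \<kappa>_nonneg[OF r, of t] by simp
        next
          case False
          then show ?thesis
            using h[OF rn vk t] transient[OF *(2,1), of t] g(1)[of k] h_nonneg[of k k] by simp
        qed
      qed
      then show ?thesis using v(2) \<gamma>'k by (simp add: r_def)
    qed
  qed
  have "class_KL (\<lambda>r t. \<kappa> r * exp (- t))" using class_KL_mult_exp \<kappa>(1) by (simp add: class_K_inf_def)
  then have "ISS_wrt f K" unfolding ISS_wrt_def using \<gamma>'(1) estimate by blast
  moreover have "s_invariant f s K"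
    unfolding s_invariant_def using flow_input_ball K_inv by metis
  ultimately show ?thesis using that K K_ne by blast
qed

end

theorem mainTheorem5:
  fixes f :: "real ^ 'n \<Rightarrow> real ^ 'm \<Rightarrow> real ^ 'n"
  assumes "local_lipschitz UNIV UNIV (\<lambda>u x. f x u)"
    and "forward_complete f"
  shows "(ISpS f \<longleftrightarrow>
            (\<forall>s>0. \<exists>A. compact A \<and> A \<noteq> {} \<and> s_invariant f s A \<and> ISS_wrt f A)) \<and>
         (ISpS f \<longleftrightarrow> compact_ISS f) \<and>
         (ISpS f \<longleftrightarrow> (\<exists>A. bounded A \<and> A \<noteq> {} \<and> LIM_wrt f A))"
proof -
  interpret control_system f by unfold_locales fact+
  let ?ISS = "\<lambda>s. \<exists>A. compact A \<and> A \<noteq> {} \<and> s_invariant f s A \<and> ISS_wrt f A"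
  let ?LIM = "\<exists>A. bounded A \<and> A \<noteq> {} \<and> LIM_wrt f A"
  have 1: "?LIM" if "ISpS f" using ISpS_imp_LIM_wrt[OF that] by blast
  have 2: "?ISS s" if "?LIM" "s > 0" for s using that LIM_wrt_imp_ISS_wrt by metis
  \<comment> \<open>The instance \<open>s = 1\<close> of (ii) is enough for (i), and also for (iii)
    because invariance passes to smaller input bounds.\<close>
  have 3: "ISpS f" if "?ISS 1"
    using that ISS_wrt_imp_ISpS_wrt compact_imp_bounded unfolding ISpS_def by blast
  have 4: "compact_ISS f" if "?ISS 1"
  proof -
    obtain A where A: "compact A" "A \<noteq> {}" "s_invariant f 1 A" "ISS_wrt f A" using \<open>?ISS 1\<close> by blast
    have "s_invariant f 0 A" using A(3) unfolding s_invariant_def by force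
    then show ?thesis using A ISS_wrt_imp_UAG_wrt unfolding compact_ISS_def by blast
  qed
  have 5: "?LIM" if "compact_ISS f"
    using that UAG_wrt_imp_LIM_wrt compact_imp_bounded unfolding compact_ISS_def by blast
  show ?thesis using 1 2 3 4 5 zero_less_one by blast
qed

end
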